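(* Let $(V_\varepsilon)_{\varepsilon>0}$ be a family of zonal kernels on $\mathbb S^{n-1}$ satisfying the localization assumption (stated in the context). Then $\sqrt[*]{V_\varepsilon}\in H^1(\mathbb S^{n-1}\times\mathbb S^{n-1})$ for every $\varepsilon>0$.
   Context: Let $n\ge2$. $\mathbb S^{n-1}\subset\mathbb R^n$ is the unit sphere with its round metric and normalized surface measure $\sigma$; $L^2$ and $H^1$ spaces are taken with respect to $\sigma$ (and $\sigma\otimes\sigma$ on the product). A kernel $W:\mathbb S^{n-1}\times\mathbb S^{n-1}\to\mathbb R$ is zonal if $W(x,y)$ depends only on $\langle x,y\rangle$. For $l\in\mathbb N_0$, $Z_l(x,y)=\sum_kY_{l,k}(x)Y_{l,k}(y)$, where $(Y_{l,k})_k$ is any real $L^2(\sigma)$-orthonormal basis of the spherical harmonics of degree $l$. The spherical harmonics decomposition of a zonal kernel $W$ is $\hat W_l=\frac1{Z_l(x_0,x_0)}\int W(x_0,y)Z_l(x_0,y)\,d\sigma(y)$ (independent of $x_0$). Localization assumption: $(V_\varepsilon)_{\varepsilon>0}$ are zonal kernels in $C^2(\mathbb S^{n-1}\times\mathbb S^{n-1})$ such that (i) $V_\varepsilon\ge0$ and $\int V_\varepsilon(x,\cdot)\,d\sigma=1$ for all $\varepsilon>0$, $x\in\mathbb S^{n-1}$; (ii) there is $C>0$ with $0\le\hat V_{\varepsilon,l}\le C$ for all $\varepsilon>0$, $l\in\mathbb N_0$, and $\sum_l l^n\hat V_{\varepsilon,l}<\infty$ for every $\varepsilon>0$; (iii)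 $\hat V_{\varepsilon,l}\to1$ as $\varepsilon\to0$ for every $l\in\mathbb N_0$. Convolution square root: $\sqrt[*]{V_\varepsilon}(x_0,\cdot):=\lim_{L\to\infty}\sum_{l\le L}\sqrt{\hat V_{\varepsilon,l}}\,Z_l(x_0,\cdot)$, the limit being taken in $L^2(\mathbb S^{n-1})$. *)

theory Defs
  imports "HOL-Analysis.Analysis"
begin

section \<open>The unit sphere and its normalized surface measure\<close>

text \<open>The dimension \<open>n\<close> of the ambient space is \<open>CARD('n)\<close>.\<close>

abbreviation unit_sphere :: "(real^'n) set" where
  "unit_sphere \<equiv> sphere 0 1"

text \<open>Cone construction of the surface measure: the normalized measure of \<open>A \<subseteq> unit_sphere\<close> is the
  proportion of the volume of the unit ball occupied by the cone \<open>{x. sgn x \<in> A}\<close>, where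
  \<open>sgn x = x /\<^sub>R norm x\<close>. (The origin, where \<open>sgn 0 = 0\<close>, is a null set.)\<close>

definition sphere_measure :: "(real^'n) measure" where
  "sphere_measure =
     restrict_space (distr (uniform_measure lborel (ball 0 1)) borel sgn) unit_sphere"

definition sphere2_measure :: "((real^'n) \<times> (real^'n)) measure" where
  "sphere2_measure = sphere_measure \<Otimes>\<^sub>M sphere_measure"

definition square_integrable :: "'a measure \<Rightarrow> ('a \<Rightarrow> real) \<Rightarrow> bool" where
  "square_integrable M f \<longleftrightarrow> f \<in> borel_measurable M \<and> integrable M (\<lambda>x. (f x)\<^sup>2)"


section \<open>Smooth functions and Riemannian gradients on the product of spheres\<close>

abbreviation sphere2 :: "((real^'n) \<times> (real^'n)) set" where
  "sphere2 \<equiv> unit_sphere \<times> unit_sphere"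

text \<open>\<open>C\<^sup>k\<close> on an open set \<open>U\<close> (of a Euclidean space), through iterated directional derivatives.\<close>

primrec Ck_on :: "nat \<Rightarrow> 'a::euclidean_space set \<Rightarrow> ('a \<Rightarrow> real) \<Rightarrow> bool" where
  "Ck_on 0 U f \<longleftrightarrow> continuous_on U f"
| "Ck_on (Suc k) U f \<longleftrightarrow>
     (\<forall>x\<in>U. f differentiable (at x)) \<and> (\<forall>v. Ck_on k U (\<lambda>x. frechet_derivative f (at x) v))"

text \<open>\<open>C\<^sup>k\<close> functions on an embedded submanifold \<open>M\<close>, \<open>k \<in> {0, 1, \<dots>, \<infinity>}\<close>: those which are locally
  restrictions of \<open>C\<^sup>k\<close> functions of the ambient space.\<close>

definition Ck_submanifold :: "enat \<Rightarrow> 'a::euclidean_space set \<Rightarrow> ('a \<Rightarrow> real) \<Rightarrow> bool" where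
  "Ck_submanifold k M f \<longleftrightarrow>
     (\<forall>p\<in>M. \<exists>U F. open U \<and> p \<in> U \<and> (\<forall>j. enat j \<le> k \<longrightarrow> Ck_on j U F) \<and> (\<forall>q\<in>U \<inter> M. F q = f q))"

text \<open>The Riemannian gradient on \<open>sphere2\<close> (with the product of the round metrics): the tangent
  vector representing the differential. The derivative within \<open>sphere2\<close> constrains a linear
  functional only along the tangent space, so tangency of \<open>g\<close> makes it unique when \<open>n \<ge> 2\<close>.\<close>

definition sphere2_gradient ::
  "((real^'n) \<times> (real^'n) \<Rightarrow> real) \<Rightarrow> (real^'n) \<times> (real^'n) \<Rightarrow> (real^'n) \<times> (real^'n)" where
  "sphere2_gradient f p =
     (THE g. fst g \<bullet> fst p = 0 \<and> snd g \<bullet> snd p = 0 \<and>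
        (f has_derivative (\<lambda>v. g \<bullet> v)) (at p within sphere2))"

text \<open>\<open>H\<^sup>1\<close> of the closed manifold \<open>sphere2\<close> as the completion of the smooth functions in the norm
  \<open>(\<parallel>f\<parallel>\<^sup>2 + \<parallel>\<nabla>f\<parallel>\<^sup>2)\<^sup>1\<^sup>/\<^sup>2\<close>, realized inside \<open>L\<^sup>2\<close>: the \<open>L\<^sup>2\<close> limits of smooth functions whose gradients
  are Cauchy in \<open>L\<^sup>2\<close>.\<close>

definition H1_sphere2 :: "((real^'n) \<times> (real^'n) \<Rightarrow> real) set" where
  "H1_sphere2 = {f. square_integrable sphere2_measure f \<and>
     (\<exists>\<phi> :: nat \<Rightarrow> (real^'n) \<times> (real^'n) \<Rightarrow> real.
        (\<forall>k. Ck_submanifold \<infinity> sphere2 (\<phi> k)) \<and>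
        (\<lambda>k. LINT p|sphere2_measure. (\<phi> k p - f p)\<^sup>2) \<longlonglongrightarrow> 0 \<and>
        (\<forall>e>0. \<exists>N. \<forall>j\<ge>N. \<forall>k\<ge>N.
           (LINT p|sphere2_measure.
              (norm (sphere2_gradient (\<phi> j) p - sphere2_gradient (\<phi> k) p))\<^sup>2) < e))}"


section \<open>Spherical harmonics\<close>

definition laplacian :: "(real^'n \<Rightarrow> real) \<Rightarrow> real^'n \<Rightarrow> real" where
  "laplacian p x = (\<Sum>i\<in>UNIV. (deriv ^^ 2) (\<lambda>t. p (x + t *\<^sub>R axis i 1)) 0)"

definition spherical_harmonic :: "nat \<Rightarrow> (real^'n \<Rightarrow> real) \<Rightarrow> bool" where
  "spherical_harmonic l f \<longleftrightarrow>
     (\<exists>p. real_polynomial_function p \<and> (\<forall>c x. p (c *\<^sub>R x) = c ^ l * p x) \<and>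
        (\<forall>x. laplacian p x = 0) \<and> (\<forall>x\<in>unit_sphere. f x = p x))"

definition harmonic_onb :: "nat \<Rightarrow> (real^'n \<Rightarrow> real) set \<Rightarrow> bool" where
  "harmonic_onb l B \<longleftrightarrow> finite B \<and> (\<forall>f\<in>B. spherical_harmonic l f) \<and>
     (\<forall>f\<in>B. \<forall>g\<in>B. (LINT x|sphere_measure. f x * g x) = (if f = g then 1 else 0)) \<and>
     (\<forall>f. spherical_harmonic l f \<longrightarrow> (\<exists>c. \<forall>x\<in>unit_sphere. f x = (\<Sum>g\<in>B. c g * g x)))"

text \<open>In the following, \<open>Y l\<close> is the set of the members of an orthonormal basis of the spherical
  harmonics of degree \<open>l\<close>; none of the notions depends on its choice.\<close>

definition zonal_harmonic ::
  "(nat \<Rightarrow> (real^'n \<Rightarrow> real) set) \<Rightarrow> nat \<Rightarrow> real^'n \<Rightarrow> real^'n \<Rightarrow> real" where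
  "zonal_harmonic Y l x y = (\<Sum>f\<in>Y l. f x * f y)"


section \<open>Zonal kernels\<close>

definition zonal :: "(real^'n \<Rightarrow> real^'n \<Rightarrow> real) \<Rightarrow> bool" where
  "zonal W \<longleftrightarrow> (\<exists>w :: real \<Rightarrow> real. \<forall>x\<in>unit_sphere. \<forall>y\<in>unit_sphere. W x y = w (x \<bullet> y))"

text \<open>For zonal \<open>W\<close> the value does not depend on the base point \<open>x0\<close>.\<close>

definition zonal_coeff ::
  "(nat \<Rightarrow> (real^'n \<Rightarrow> real) set) \<Rightarrow> (real^'n \<Rightarrow> real^'n \<Rightarrow> real) \<Rightarrow> nat \<Rightarrow> real" where
  "zonal_coeff Y W l =
     (let x0 = (SOME x. x \<in> unit_sphere)
      in 1 / zonal_harmonic Y l x0 x0 * (LINT y|sphere_measure. W x0 y * zonal_harmonic Y l x0 y))"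

definition localization ::
  "(nat \<Rightarrow> (real^'n \<Rightarrow> real) set) \<Rightarrow> (real \<Rightarrow> real^'n \<Rightarrow> real^'n \<Rightarrow> real) \<Rightarrow> bool" where
  "localization Y V \<longleftrightarrow>
     (\<forall>\<epsilon>>0. zonal (V \<epsilon>) \<and> Ck_submanifold 2 sphere2 (\<lambda>(x, y). V \<epsilon> x y)) \<and>
     (\<forall>\<epsilon>>0. \<forall>x\<in>unit_sphere.
        (\<forall>y\<in>unit_sphere. V \<epsilon> x y \<ge> 0) \<and> (LINT y|sphere_measure. V \<epsilon> x y) = 1) \<and>
     (\<exists>C>0. \<forall>\<epsilon>>0. \<forall>l. 0 \<le> zonal_coeff Y (V \<epsilon>) l \<and> zonal_coeff Y (V \<epsilon>) l \<le> C) \<and>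
     (\<forall>\<epsilon>>0. summable (\<lambda>l. real l ^ CARD('n) * zonal_coeff Y (V \<epsilon>) l)) \<and>
     (\<forall>l. ((\<lambda>\<epsilon>. zonal_coeff Y (V \<epsilon>) l) \<longlongrightarrow> 1) (at_right 0))"

text \<open>\<open>K\<close> is the convolution square root of \<open>W\<close>: for every \<open>x\<close> in the sphere, the function \<open>K x\<close> is
  the \<open>L\<^sup>2\<close> limit of the partial sums. This determines each \<open>K x\<close> only up to a null set; the joint
  measurability makes \<open>K\<close> a well-defined class of functions on the product.\<close>

definition is_conv_sqrt ::
  "(nat \<Rightarrow> (real^'n \<Rightarrow> real) set) \<Rightarrow> (real^'n \<Rightarrow> real^'n \<Rightarrow> real) \<Rightarrow>
     (real^'n \<Rightarrow> real^'n \<Rightarrow> real) \<Rightarrow> bool" where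
  "is_conv_sqrt Y W K \<longleftrightarrow>
     (\<lambda>(x, y). K x y) \<in> borel_measurable sphere2_measure \<and>
     (\<forall>x\<in>unit_sphere. square_integrable sphere_measure (K x) \<and>
        (\<lambda>L. LINT y|sphere_measure.
           ((\<Sum>l\<le>L. sqrt (zonal_coeff Y W l) * zonal_harmonic Y l x y) - K x y)\<^sup>2) \<longlonglongrightarrow> 0)"

end

theory Submission
  imports Defs "HOL-Probability.Probability_Measure"
begin

text \<open>Write \<open>a\<^sub>l\<close> for the coefficients of \<open>V\<^sub>\<epsilon>\<close>, \<open>d\<^sub>l\<close> for the dimension of the space of spherical harmonics of
  degree \<open>l\<close>, and \<open>\<lambda>\<^sub>l = l(l + n - 2)\<close>. The partial sums of the convolution square root are smooth.
  Harmonics of different degrees are orthogonal, \<open>Z\<^sub>l(x, x) = d\<^sub>l\<close>, and \<open>\<integral> \<bar>\<nabla>f\<bar>\<^sup>2 = \<lambda>\<^sub>l \<integral> f\<^sup>2\<close> for \<open>f\<close> of degree \<open>l\<close>;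
  hence a block of partial sums has squared norm \<open>\<Sum> a\<^sub>l d\<^sub>l\<close> in every fibre and squared gradient norm
  \<open>2 \<Sum> a\<^sub>l \<lambda>\<^sub>l d\<^sub>l\<close> on the product. As \<open>d\<^sub>l = O(l\<^sup>n\<^sup>-\<^sup>2)\<close>, both are tails of series dominated by
  \<open>\<Sum> l\<^sup>n a\<^sub>l\<close>. Integration by parts on the sphere is replaced by the invariance of the measure under
  rotations: the rotation fields \<open>x\<^sub>i \<partial>\<^sub>j - x\<^sub>j \<partial>\<^sub>i\<close> are skew-symmetric, and half of the sum of their squares is
  the Laplace--Beltrami operator.\<close>

section \<open>Directional derivatives of polynomials\<close>

text \<open>The convolution square root is prescribed fibre by fibre and only up to null sets, so
  limits chosen separately need not be measurable in the pair. What saves joint measurability is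
  that a block of partial sums has the same norm in every fibre, because the diagonal of the zonal
  harmonics is constant. The rate of convergence is then uniform in \<open>x\<close>, and one
  subsequence converges almost everywhere in each fibre. Membership in H^1 is shown for every
  admissible kernel, not only for the one constructed. The growth bound for the number of harmonics
  comes from uniqueness in the Cauchy problem for the Laplace equation: a harmonic form of degree
  \<open>l\<close> is determined by those derivatives of order \<open>l\<close> at the origin that
  are at most of first order in one fixed direction, and these are easily counted. Elements of a
  basis are prescribed on the sphere only. All calculus is therefore done on polynomial extensions,
  and the intrinsic gradient has to be shown to agree with the tangential part of the ambient
  one.\<close>

definition dirderiv :: "'a::real_normed_vector \<Rightarrow> ('a \<Rightarrow> real) \<Rightarrow> 'a \<Rightarrow> real" where
  "dirderiv v p x = frechet_derivative p (at x) v"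

lemma dirderivI: "(p has_derivative D) (at x) \<Longrightarrow> dirderiv v p x = D v"
  unfolding dirderiv_def by (metis frechet_derivative_at)

lemma real_polynomial_has_derivative:
  "real_polynomial_function p \<Longrightarrow> (p has_derivative (\<lambda>v. dirderiv v p x)) (at x)"
  unfolding dirderiv_def using frechet_derivative_works differentiable_at_real_polynomial_function by blast

lemma continuous_on_real_polynomial: "real_polynomial_function q \<Longrightarrow> continuous_on S q"
  using continuous_on_polymonial_function real_polynomial_function_eq by blast

lemma dirderiv_const [simp]: "dirderiv v (\<lambda>x. c) = (\<lambda>x. 0)"
  by (auto intro!: dirderivI ext)

lemma dirderiv_linear: "bounded_linear f \<Longrightarrow> dirderiv v f = (\<lambda>x. f v)"
  by (auto intro!: dirderivI ext bounded_linear_imp_has_derivative)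

lemma dirderiv_add:
  "real_polynomial_function p \<Longrightarrow> real_polynomial_function q \<Longrightarrow>
     dirderiv v (\<lambda>x. p x + q x) = (\<lambda>x. dirderiv v p x + dirderiv v q x)"
  by (rule ext, rule dirderivI) (intro derivative_intros real_polynomial_has_derivative)

lemma dirderiv_mult:
  "real_polynomial_function p \<Longrightarrow> real_polynomial_function q \<Longrightarrow>
     dirderiv v (\<lambda>x. p x * q x) = (\<lambda>x. p x * dirderiv v q x + dirderiv v p x * q x)"
  by (rule ext, rule dirderivI) (intro has_derivative_mult real_polynomial_has_derivative)

lemma dirderiv_cmult:
  "real_polynomial_function p \<Longrightarrow> dirderiv v (\<lambda>x. c * p x) = (\<lambda>x. c * dirderiv v p x)"
  by (simp add: dirderiv_mult real_polynomial_function.intros(2))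

lemma dirderiv_sum:
  "finite I \<Longrightarrow> (\<And>i. i \<in> I \<Longrightarrow> real_polynomial_function (p i)) \<Longrightarrow>
     dirderiv v (\<lambda>x. \<Sum>i\<in>I. p i x) = (\<lambda>x. \<Sum>i\<in>I. dirderiv v (p i) x)"
  by (rule ext, rule dirderivI) (intro has_derivative_sum real_polynomial_has_derivative)

lemma real_polynomial_dirderiv:
  "real_polynomial_function p \<Longrightarrow> real_polynomial_function (dirderiv v p)"
proof (induction rule: real_polynomial_function.induct)
  case (linear f) then show ?case by (simp add: dirderiv_linear real_polynomial_function.intros(2))
next
  case (const c) then show ?case by (simp add: real_polynomial_function.intros(2))
next
  case (add f g) then show ?case by (simp add: dirderiv_add real_polynomial_function.intros(3))
next
  case (mult f g)
  then show ?case by (auto simp add: dirderiv_mult)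
qed

text \<open>Induction over the construction of polynomials: for linear functions both sides vanish,
  and the twofold product rule is symmetric in the two directions.\<close>

lemma dirderiv_commute:
  "real_polynomial_function p \<Longrightarrow> dirderiv v (dirderiv w p) = dirderiv w (dirderiv v p)"
proof (induction rule: real_polynomial_function.induct)
  case (linear f) then show ?case by (simp add: dirderiv_linear)
next
  case (const c) then show ?case by simp
next
  case (add f g) then show ?case by (simp add: dirderiv_add real_polynomial_dirderiv)
next
  case (mult f g)
  then show ?case
    by (simp add: dirderiv_mult dirderiv_add real_polynomial_dirderiv real_polynomial_function.intros(4)
        algebra_simps)
qed

lemma dirderiv_linear_dir:
  assumes "real_polynomial_function p"
  shows "bounded_linear (\<lambda>v. dirderiv v p x)"
  using real_polynomial_has_derivative[OF assms] by (rule has_derivative_bounded_linear)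

lemma dirderiv_axis_expand:
  fixes p :: "real^'n \<Rightarrow> real"
  assumes "real_polynomial_function p"
  shows "dirderiv v p x = (\<Sum>i\<in>UNIV. v$i * dirderiv (axis i 1) p x)"
proof -
  interpret bounded_linear "\<lambda>v. dirderiv v p x" by (rule dirderiv_linear_dir[OF assms])
  have "dirderiv v p x = dirderiv (\<Sum>i\<in>UNIV. v$i *\<^sub>R axis i 1) p x"
    by (simp add: basis_expansion[where 'a=real, unfolded scalar_mult_eq_scaleR])
  also have "\<dots> = (\<Sum>i\<in>UNIV. v$i * dirderiv (axis i 1) p x)"
    by (simp add: sum scaleR)
  finally show ?thesis .
qed

lemma Ck_on_real_polynomial:
  "real_polynomial_function p \<Longrightarrow> Ck_on k UNIV p"
proof (induction k arbitrary: p)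
  case 0
  then show ?case
    by (auto intro!: continuous_at_imp_continuous_on differentiable_imp_continuous_within differentiable_at_real_polynomial_function)
next
  case (Suc k)
  then show ?case
    using real_polynomial_dirderiv[OF Suc.prems]
    by (auto simp: differentiable_at_real_polynomial_function dirderiv_def[symmetric])
qed

lemma dirderiv_along_line:
  assumes "real_polynomial_function p"
  shows "((\<lambda>t. p (x + t *\<^sub>R v)) has_real_derivative dirderiv v p (x + t *\<^sub>R v)) (at t)"
proof -
  interpret bounded_linear "\<lambda>w. dirderiv w p (x + t *\<^sub>R v)" by (rule dirderiv_linear_dir[OF assms])
  have "((\<lambda>t. x + t *\<^sub>R v) has_derivative (\<lambda>h. h *\<^sub>R v)) (at t)"
    by (auto intro!: derivative_eq_intros)
  from has_derivative_compose[OF this real_polynomial_has_derivative[OF assms]]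
  show ?thesis by (simp add: has_field_derivative_def scaleR mult_commute_abs)
qed

lemma laplacian_real_polynomial:
  fixes p :: "real^'n \<Rightarrow> real"
  assumes "real_polynomial_function p"
  shows "laplacian p x = (\<Sum>i\<in>UNIV. dirderiv (axis i 1) (dirderiv (axis i 1) p) x)"
proof -
  have "(deriv ^^ 2) (\<lambda>t. p (x + t *\<^sub>R v)) 0 = dirderiv v (dirderiv v p) x" for v :: "real^'n"
  proof -
    have "deriv (\<lambda>t. p (x + t *\<^sub>R v)) = (\<lambda>t. dirderiv v p (x + t *\<^sub>R v))"
      by (rule ext, rule DERIV_imp_deriv, rule dirderiv_along_line[OF assms])
    then show ?thesis
      using DERIV_imp_deriv[OF dirderiv_along_line[OF real_polynomial_dirderiv[OF assms], of v x v 0]]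
      by (simp add: numeral_2_eq_2)
  qed
  then show ?thesis by (simp add: laplacian_def)
qed

text \<open>Homogeneity appears as Euler's identity: it is linear in \<open>p\<close>, and a
  derivative satisfies it again with the degree lowered by one, which makes induction on
  \<open>l\<close> possible. The conditions hold on the whole space and so fix derivatives that the
  values on the sphere leave open.\<close>

definition harmonic_form :: "nat \<Rightarrow> (real^'n \<Rightarrow> real) \<Rightarrow> bool" where
  "harmonic_form l p \<longleftrightarrow> real_polynomial_function p \<and> (\<forall>x. dirderiv x p x = real l * p x) \<and>
     (\<forall>x. (\<Sum>i\<in>UNIV. dirderiv (axis i 1) (dirderiv (axis i 1) p) x) = 0)"

lemma dirderiv_homogeneous:
  assumes "real_polynomial_function p" and hom: "\<And>c x. p (c *\<^sub>R x) = c ^ l * p x"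
  shows "dirderiv x p x = real l * p x"
proof -
  have "((\<lambda>t. p (x + t *\<^sub>R x)) has_real_derivative dirderiv x p (x + 0 *\<^sub>R x)) (at 0)"
    by (rule dirderiv_along_line[OF assms(1)])
  moreover have "p (x + t *\<^sub>R x) = (1 + t) ^ l * p x" for t
    using hom[of "1+t" x] by (simp add: algebra_simps)
  ultimately have "((\<lambda>t. (1 + t) ^ l * p x) has_real_derivative dirderiv x p x) (at 0)" by simp
  moreover have "((\<lambda>t. (1 + t) ^ l * p x) has_real_derivative real l * p x) (at 0)"
    by (auto intro!: derivative_eq_intros)
  ultimately show ?thesis by (rule DERIV_unique)
qed

lemma spherical_harmonic_form:
  assumes "spherical_harmonic l f"
  obtains p where "harmonic_form l p" "\<And>x. norm x = 1 \<Longrightarrow> f x = p x"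
proof -
  from assms obtain p where p: "real_polynomial_function p" "\<forall>c x. p (c *\<^sub>R x) = c ^ l * p x"
    "\<forall>x. laplacian p x = 0" "\<forall>x\<in>unit_sphere. f x = p x"
    unfolding spherical_harmonic_def by blast
  then have "harmonic_form l p"
    by (auto simp: harmonic_form_def laplacian_real_polynomial dirderiv_homogeneous)
  with p(4) that show ?thesis by simp
qed

text \<open>Along the ray through \<open>x\<close>, the derivative at \<open>t > 0\<close> is
  Euler's expression divided by \<open>t\<close>, hence zero; continuity carries the constancy to
  \<open>t = 0\<close>.\<close>

lemma homogeneous_degree_zero:
  assumes p: "real_polynomial_function p" and E: "\<And>x. dirderiv x p x = 0"
  shows "p x = p 0"
proof -
  have d: "((\<lambda>t. p (t *\<^sub>R x)) has_real_derivative dirderiv x p (t *\<^sub>R x)) (at t)" for t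
    using dirderiv_along_line[OF p, of 0 x t] by simp
  have "dirderiv x p (t *\<^sub>R x) = 0" if "t > 0" for t
  proof -
    interpret bounded_linear "\<lambda>v. dirderiv v p (t *\<^sub>R x)" by (rule dirderiv_linear_dir[OF p])
    show ?thesis using E[of "t *\<^sub>R x"] that by (simp add: scaleR)
  qed
  with d have "\<And>t. 0 < t \<Longrightarrow> ((\<lambda>t. p (t *\<^sub>R x)) has_real_derivative 0) (at t)" by metis
  moreover have "continuous_on {0..1} (\<lambda>t. p (t *\<^sub>R x))"
    using d by (meson DERIV_isCont continuous_at_imp_continuous_on)
  ultimately have "p (1 *\<^sub>R x) = p (0 *\<^sub>R x)"
    using DERIV_isconst_end[of 0 1 "\<lambda>t. p (t *\<^sub>R x)"] by simp
  then show ?thesis by simp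
qed

text \<open>Differentiating Euler's identity in direction \<open>v\<close> also hits the
  coefficients \<open>x$i\<close>. This yields one extra copy of \<open>dirderiv v p\<close>, which
  turns \<open>c\<close> into \<open>c - 1\<close>.\<close>

lemma euler_dirderiv:
  fixes p :: "real^'n \<Rightarrow> real"
  assumes p: "real_polynomial_function p" and E: "\<And>x. dirderiv x p x = c * p x"
  shows "dirderiv x (dirderiv v p) x = (c - 1) * dirderiv v p x"
proof -
  have L: "bounded_linear (\<lambda>x. x $ i)" for i :: 'n by (rule bounded_linear_vec_nth)
  have P: "real_polynomial_function (\<lambda>x. x $ i)" for i :: 'n
    using L by (rule real_polynomial_function.intros(1))
  note Q = real_polynomial_dirderiv[OF p]
  have "(\<lambda>x. \<Sum>i\<in>UNIV. x$i * dirderiv (axis i 1) p x) = (\<lambda>x. c * p x)"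
    by (rule ext) (metis E dirderiv_axis_expand[OF p])
  then have "dirderiv v (\<lambda>x. \<Sum>i\<in>UNIV. x$i * dirderiv (axis i 1) p x) x = dirderiv v (\<lambda>x. c * p x) x"
    by (rule arg_cong)
  then have "(\<Sum>i\<in>UNIV. x$i * dirderiv v (dirderiv (axis i 1) p) x + v$i * dirderiv (axis i 1) p x)
      = c * dirderiv v p x"
    by (simp add: dirderiv_cmult p dirderiv_sum dirderiv_mult P Q real_polynomial_function.intros(4)
         dirderiv_linear[OF L])
  then have "(\<Sum>i\<in>UNIV. x$i * dirderiv (axis i 1) (dirderiv v p) x) + dirderiv v p x = c * dirderiv v p x"
    by (simp add: sum.distrib dirderiv_commute[OF p, of v] dirderiv_axis_expand[OF p, of v])
  then show ?thesis by (simp add: dirderiv_axis_expand[OF Q, of x] algebra_simps)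
qed

lemma harmonic_form_dirderiv:
  fixes p :: "real^'n \<Rightarrow> real"
  assumes "harmonic_form (Suc l) p"
  shows "harmonic_form l (dirderiv v p)"
proof -
  have p: "real_polynomial_function p" and E: "\<And>x. dirderiv x p x = real (Suc l) * p x"
    and 0: "(\<lambda>x. \<Sum>i\<in>UNIV. dirderiv (axis i 1) (dirderiv (axis i 1) p) x) = (\<lambda>x. 0)"
    using assms by (auto simp: harmonic_form_def)
  have c: "dirderiv w (dirderiv w (dirderiv v p)) = dirderiv v (dirderiv w (dirderiv w p))" for w
    using p by (metis dirderiv_commute real_polynomial_dirderiv)
  have "(\<lambda>x. \<Sum>i\<in>UNIV. dirderiv v (dirderiv (axis i 1) (dirderiv (axis i 1) p)) x)
      = dirderiv v (\<lambda>x. \<Sum>i\<in>UNIV. dirderiv (axis i 1) (dirderiv (axis i 1) p) x)"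
    by (subst dirderiv_sum) (simp_all add: real_polynomial_dirderiv p)
  also have "\<dots> = (\<lambda>x. 0)" unfolding 0 by simp
  finally have "(\<lambda>x. \<Sum>i\<in>UNIV. dirderiv (axis i 1) (dirderiv (axis i 1) (dirderiv v p)) x) = (\<lambda>x. 0)"
    unfolding c .
  then show ?thesis
    using euler_dirderiv[OF p E] by (simp add: harmonic_form_def real_polynomial_dirderiv p fun_eq_iff)
qed

lemma harmonic_form_sum:
  assumes "finite I" "\<And>i. i \<in> I \<Longrightarrow> harmonic_form l (p i)"
  shows "harmonic_form l (\<lambda>x. \<Sum>i\<in>I. c i * p i x)"
proof -
  have p: "real_polynomial_function (p i)" if "i \<in> I" for i using assms(2)[OF that] by (simp add: harmonic_form_def)
  have q: "real_polynomial_function (\<lambda>x. c i * p i x)" if "i \<in> I" for i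
    using p[OF that] by auto
  have D: "dirderiv v (\<lambda>x. \<Sum>i\<in>I. c i * p i x) = (\<lambda>x. \<Sum>i\<in>I. c i * dirderiv v (p i) x)" for v
    by (simp add: dirderiv_sum assms(1) q dirderiv_cmult p)
  have D2: "dirderiv v (\<lambda>x. \<Sum>i\<in>I. c i * dirderiv v (p i) x) = (\<lambda>x. \<Sum>i\<in>I. c i * dirderiv v (dirderiv v (p i)) x)" for v
  proof -
    have "real_polynomial_function (\<lambda>x. c i * dirderiv v (p i) x)" if "i \<in> I" for i
      using real_polynomial_dirderiv[OF p[OF that]] by auto
    then show ?thesis by (simp add: dirderiv_sum assms(1) dirderiv_cmult p real_polynomial_dirderiv)
  qed
  show ?thesis unfolding harmonic_form_def
  proof (intro conjI allI)
    show "real_polynomial_function (\<lambda>x. \<Sum>i\<in>I. c i * p i x)" using q assms(1) by auto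
    fix x
    show "dirderiv x (\<lambda>x. \<Sum>i\<in>I. c i * p i x) x = real l * (\<Sum>i\<in>I. c i * p i x)"
      using assms(2) unfolding D by (simp add: harmonic_form_def sum_distrib_left mult.left_commute)
    have "(\<Sum>j\<in>UNIV. dirderiv (axis j 1) (dirderiv (axis j 1) (\<lambda>x. \<Sum>i\<in>I. c i * p i x)) x)
        = (\<Sum>i\<in>I. c i * (\<Sum>j\<in>UNIV. dirderiv (axis j 1) (dirderiv (axis j 1) (p i)) x))"
      unfolding D D2 by (simp add: sum_distrib_left) (rule sum.swap)
    also have "\<dots> = 0" using assms(2) by (simp add: harmonic_form_def)
    finally show "(\<Sum>j\<in>UNIV. dirderiv (axis j 1) (dirderiv (axis j 1) (\<lambda>x. \<Sum>i\<in>I. c i * p i x)) x) = 0" .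
  qed
qed

section \<open>The surface measure\<close>

lemma borel_measurable_sgn_vec: "(sgn :: 'a::euclidean_space \<Rightarrow> 'a) \<in> borel_measurable borel"
  unfolding sgn_div_norm by measurable

lemma space_sphere_measure [simp]: "space sphere_measure = unit_sphere"
  by (simp add: sphere_measure_def space_restrict_space)

lemma sets_sphere_measure [measurable_cong]: "sets sphere_measure = sets (restrict_space borel unit_sphere)"
  unfolding sphere_measure_def by (intro sets_restrict_space_cong) simp

lemma prob_space_uniform_ball: "prob_space (uniform_measure lborel (ball (0::real^'n) 1))"
proof (rule prob_space_uniform_measure)
  have "0 < measure lborel (ball (0::real^'n) 1)"
    using content_ball_pos[of 1 "0::real^'n"] by (simp add: measure_def)
  then show "emeasure lborel (ball (0::real^'n) 1) \<noteq> 0" by (auto simp: measure_def)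
  show "emeasure lborel (ball (0::real^'n) 1) \<noteq> \<infinity>" using emeasure_bounded_finite[of "ball (0::real^'n) 1"] by simp
qed

lemma AE_uniform_ball_sgn:
  "AE x in uniform_measure lborel (ball (0::real^'n) 1). sgn x \<in> unit_sphere"
proof -
  have "AE x in lborel. x \<noteq> (0::real^'n)" by (rule AE_lborel_singleton)
  then have "AE x in uniform_measure lborel (ball (0::real^'n) 1). x \<noteq> 0"
    by (intro AE_uniform_measureI) auto
  then show ?thesis by eventually_elim (simp add: norm_sgn)
qed

lemma prob_space_sphere_measure: "prob_space (sphere_measure :: (real^'n) measure)"
  unfolding sphere_measure_def
proof (rule prob_space_restrict_space)
  interpret U: prob_space "uniform_measure lborel (ball (0::real^'n) 1)" by (rule prob_space_uniform_ball)
  have m: "sgn \<in> measurable (uniform_measure lborel (ball (0::real^'n) 1)) borel"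
    using borel_measurable_sgn_vec[where 'a="real^'n"] by simp
  show "unit_sphere \<in> sets (distr (uniform_measure lborel (ball (0::real^'n) 1)) borel sgn)"
    by simp
  interpret D: prob_space "distr (uniform_measure lborel (ball (0::real^'n) 1)) borel sgn"
    using m by (rule U.prob_space_distr)
  have "AE x in distr (uniform_measure lborel (ball (0::real^'n) 1)) borel sgn. x \<in> unit_sphere"
    using AE_uniform_ball_sgn by (subst AE_distr_iff[OF m]) simp_all
  then show "emeasure (distr (uniform_measure lborel (ball (0::real^'n) 1)) borel sgn) unit_sphere = 1"
    by (subst D.emeasure_eq_1_AE) auto
qed

interpretation sphere_measure: prob_space "sphere_measure :: (real^'n) measure"
  by (rule prob_space_sphere_measure)

lemma borel_measurable_sphere_measure:
  "continuous_on unit_sphere f \<Longrightarrow> f \<in> borel_measurable sphere_measure"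
  using borel_measurable_continuous_on_restrict measurable_cong_sets[OF sets_sphere_measure refl] by blast

lemma integrable_sphere_measure:
  fixes f :: "real^'n \<Rightarrow> 'b::{second_countable_topology, banach}"
  assumes "continuous_on unit_sphere f"
  shows "integrable sphere_measure f"
proof -
  have "compact (f ` unit_sphere)" using assms compact_continuous_image compact_sphere by blast
  then obtain B where "\<forall>y\<in>f ` unit_sphere. norm y \<le> B" using compact_imp_bounded bounded_iff by blast
  then show ?thesis
    using borel_measurable_sphere_measure[OF assms]
    by (intro sphere_measure.integrable_const_bound[where B=B]) (auto intro!: AE_I2)
qed

text \<open>The sign \<open>-1\<close> is for integrals over \<open>t - y\<close>, which appear once
  the roles of the two sets are exchanged in the next proof.\<close>

lemma nn_integral_lborel_affine:
  fixes f :: "'a::euclidean_space \<Rightarrow> ennreal"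
  assumes [measurable]: "f \<in> borel_measurable borel" and c: "c = 1 \<or> c = (-1::real)"
  shows "(\<integral>\<^sup>+x. f (t + c *\<^sub>R x) \<partial>lborel) = (\<integral>\<^sup>+x. f x \<partial>lborel)"
proof -
  have "lborel = distr lborel borel (\<lambda>x::'a. t + c *\<^sub>R x)"
    using lborel_affine[of c t] c by (auto simp: density_1)
  then have "(\<integral>\<^sup>+x. f x \<partial>lborel) = (\<integral>\<^sup>+x. f x \<partial>distr lborel borel (\<lambda>x::'a. t + c *\<^sub>R x))"
    by simp
  also have "\<dots> = (\<integral>\<^sup>+x. f (t + c *\<^sub>R x) \<partial>lborel)"
    by (subst nn_integral_distr) simp_all
  finally show ?thesis by simp
qed

text \<open>The library knows the invariance of Lebesgue measure under orthogonal maps only for well-ordered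
  index types. Uniqueness of Haar measure gives it in general: by translation invariance, a double
  integral of \<open>1\<^sub>A(T x) 1\<^sub>B(T x + y)\<close> is symmetric under exchanging \<open>A\<close> and \<open>B\<close>; take for \<open>B\<close> the unit
  ball, which \<open>T\<close> preserves.\<close>

lemma emeasure_lborel_orthogonal:
  fixes T :: "'a::euclidean_space \<Rightarrow> 'a"
  assumes T: "orthogonal_transformation T" and A: "A \<in> sets borel"
  shows "emeasure lborel (T -` A) = emeasure lborel A"
proof -
  define B where "B = ball (0::'a) 1"
  note A [measurable]
  have B [measurable]: "B \<in> sets borel" by (simp add: B_def)
  have lin: "linear T" using T by (simp add: orthogonal_transformation_linear)
  then have m [measurable]: "T \<in> borel_measurable borel"
    by (intro borel_measurable_continuous_onI linear_continuous_on) (simp add: linear_conv_bounded_linear)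
  have TB: "T -` B = B" using T by (auto simp: B_def orthogonal_transformation_norm)
  \<comment> \<open>A translation by \<open>y\<close> after \<open>T\<close> is a translation by
    \<open>inv T y\<close> before it, so the inner integral can be shifted in
    \<open>x\<close>.\<close>
  have shift: "T (inv T y + x) = y + T x" for x y
    using lin T by (simp add: linear_add surj_f_inv_f orthogonal_transformation_surj)
  have TA [measurable]: "T -` A \<in> sets borel" by (rule measurable_sets_borel[OF m A])
  let ?i = "\<lambda>S x. indicator S x :: ennreal"
  have t: "(\<integral>\<^sup>+y. ?i S (t + y) \<partial>lborel) = emeasure lborel S"
       "(\<integral>\<^sup>+y. ?i S (t - y) \<partial>lborel) = emeasure lborel S" if "S \<in> sets borel" for S :: "'a set" and t
    using nn_integral_lborel_affine[of "?i S" 1 t] nn_integral_lborel_affine[of "?i S" "-1" t] that by simp_all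
  have "emeasure lborel (T -` A) * emeasure lborel B = (\<integral>\<^sup>+x. ?i A (T x) * emeasure lborel B \<partial>lborel)"
  proof -
    have "(\<integral>\<^sup>+x. ?i A (T x) \<partial>lborel) = (\<integral>\<^sup>+x. ?i (T -` A) x \<partial>lborel)"
      by (intro nn_integral_cong) (simp add: indicator_def)
    then show ?thesis by (simp add: nn_integral_multc)
  qed
  also have "\<dots> = (\<integral>\<^sup>+x. \<integral>\<^sup>+y. ?i A (T x) * ?i B (T x + y) \<partial>lborel \<partial>lborel)"
    by (simp add: nn_integral_cmult t)
  also have "\<dots> = (\<integral>\<^sup>+y. \<integral>\<^sup>+x. ?i A (T x) * ?i B (T x + y) \<partial>lborel \<partial>lborel)"
    by (rule lborel_pair.Fubini') simp
  also have "\<dots> = (\<integral>\<^sup>+y. \<integral>\<^sup>+x. ?i A (T x - y) * ?i B (T x) \<partial>lborel \<partial>lborel)"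
  proof (rule nn_integral_cong)
    fix y :: 'a
    have "(\<integral>\<^sup>+x. ?i A (T x - y) * ?i B (T x) \<partial>lborel)
        = (\<integral>\<^sup>+x. ?i A (T (inv T y + 1 *\<^sub>R x) - y) * ?i B (T (inv T y + 1 *\<^sub>R x)) \<partial>lborel)"
      by (rule nn_integral_lborel_affine[symmetric]) simp_all
    then show "(\<integral>\<^sup>+x. ?i A (T x) * ?i B (T x + y) \<partial>lborel) = (\<integral>\<^sup>+x. ?i A (T x - y) * ?i B (T x) \<partial>lborel)"
      by (simp add: shift add.commute[of _ y])
  qed
  also have "\<dots> = (\<integral>\<^sup>+x. \<integral>\<^sup>+y. ?i A (T x - y) * ?i B (T x) \<partial>lborel \<partial>lborel)"
    by (rule lborel_pair.Fubini') simp
  also have "\<dots> = (\<integral>\<^sup>+x. emeasure lborel A * ?i B (T x) \<partial>lborel)"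
    by (simp add: nn_integral_multc t)
  also have "\<dots> = emeasure lborel A * emeasure lborel B"
  proof -
    have "(\<integral>\<^sup>+x. ?i B (T x) \<partial>lborel) = (\<integral>\<^sup>+x. ?i (T -` B) x \<partial>lborel)"
      by (intro nn_integral_cong) (simp add: indicator_def)
    then show ?thesis by (simp add: nn_integral_cmult TB)
  qed
  finally have "emeasure lborel (T -` A) * emeasure lborel B = emeasure lborel A * emeasure lborel B" .
  moreover have "emeasure lborel B \<noteq> 0" "emeasure lborel B \<noteq> \<infinity>"
    using emeasure_lborel_ball_finite[of 0 1] content_ball_pos[of 1 "0::'a"] by (auto simp: B_def measure_def)
  ultimately show ?thesis
    by (simp add: ennreal_mult_cancel_left mult.commute[of _ "emeasure lborel B"])
qed

text \<open>\<open>T\<close> commutes with \<open>sgn\<close> and preserves the unit ball. Hence the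
  cone over a preimage is the preimage of the cone, and the invariance of volume passes to the
  surface measure.\<close>

lemma distr_sphere_measure_orthogonal:
  fixes T :: "real^'n \<Rightarrow> real^'n"
  assumes T: "orthogonal_transformation T"
  shows "T \<in> measurable sphere_measure sphere_measure"
    and "distr sphere_measure sphere_measure T = sphere_measure"
proof -
  have lin: "bounded_linear T" using T by (simp add: orthogonal_transformation_linear linear_conv_bounded_linear[symmetric])
  then have m: "T \<in> borel_measurable borel"
    using linear_continuous_on borel_measurable_continuous_onI by metis
  have n: "norm (T x) = norm x" for x using T by (rule orthogonal_transformation_norm)
  show mS: "T \<in> measurable sphere_measure sphere_measure"
    using m by (subst measurable_cong_sets[OF sets_sphere_measure sets_sphere_measure])
      (auto intro!: measurable_restrict_space3 simp: n)
  have sg: "sgn (T x) = T (sgn x)" for x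
    using T by (simp add: sgn_div_norm n orthogonal_transformation_scaleR)
  have U: "emeasure (uniform_measure lborel (ball 0 1)) (T -` B) = emeasure (uniform_measure lborel (ball 0 1)) B"
    if B: "B \<in> sets borel" for B :: "(real^'n) set"
  proof -
    have TB: "T -` B \<in> sets borel" using m B by (rule measurable_sets_borel)
    have "emeasure lborel (ball 0 1 \<inter> B) = emeasure lborel (T -` (ball 0 1 \<inter> B))"
      using B by (intro emeasure_lborel_orthogonal[OF T, symmetric]) simp
    also have "T -` (ball 0 1 \<inter> B) = ball 0 1 \<inter> T -` B" by (auto simp: n)
    finally show ?thesis using B TB by simp
  qed
  show "distr sphere_measure sphere_measure T = sphere_measure"
  proof (rule measure_eqI)
    fix A assume "A \<in> sets (distr sphere_measure sphere_measure T :: (real^'n) measure)"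
    then have A: "A \<in> sets sphere_measure" by simp
    then have A1: "A \<in> sets borel" "A \<subseteq> unit_sphere"
      by (auto simp: sets_sphere_measure sets_restrict_space_iff)
    have TA: "T -` A \<in> sets borel" using m A1(1) by (rule measurable_sets_borel)
    have TA2: "T -` A \<subseteq> unit_sphere" using A1(2) by (auto simp: n)
    have E: "emeasure sphere_measure B = emeasure (uniform_measure lborel (ball 0 1)) (sgn -` B)"
      if "B \<in> sets borel" "B \<subseteq> unit_sphere" for B :: "(real^'n) set"
      using that borel_measurable_sgn_vec[where 'a="real^'n"]
      by (simp add: sphere_measure_def emeasure_restrict_space emeasure_distr)
    have sA: "sgn -` A \<in> sets borel" by (rule measurable_sets_borel[OF borel_measurable_sgn_vec A1(1)])
    have "emeasure (distr sphere_measure sphere_measure T) A = emeasure sphere_measure (T -` A)"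
      using A mS TA2 by (subst emeasure_distr) (auto simp: Int_absorb2)
    also have "\<dots> = emeasure (uniform_measure lborel (ball 0 1)) (T -` (sgn -` A))"
      using E[OF TA TA2] by (simp add: vimage_def sg)
    also have "\<dots> = emeasure sphere_measure A" using U[OF sA] E[OF A1] by simp
    finally show "emeasure (distr sphere_measure sphere_measure T) A = emeasure sphere_measure A" .
  qed simp
qed

lemma integral_sphere_orthogonal:
  fixes f :: "real^'n \<Rightarrow> 'b::{second_countable_topology, banach}" and T :: "real^'n \<Rightarrow> real^'n"
  assumes T: "orthogonal_transformation T" and f: "continuous_on unit_sphere f"
  shows "(LINT x|sphere_measure. f (T x)) = (LINT x|sphere_measure. f x)"
  using integral_distr[OF distr_sphere_measure_orthogonal(1)[OF T] borel_measurable_sphere_measure[OF f]]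
  by (simp add: distr_sphere_measure_orthogonal(2)[OF T])

section \<open>Infinitesimal rotations\<close>

definition rot_field :: "'n \<Rightarrow> 'n \<Rightarrow> real^'n \<Rightarrow> real^'n" where
  "rot_field i j x = x$i *\<^sub>R axis j 1 - x$j *\<^sub>R axis i 1"

abbreviation rot_deriv :: "'n \<Rightarrow> 'n \<Rightarrow> (real^'n \<Rightarrow> real) \<Rightarrow> real^'n \<Rightarrow> real" where
  "rot_deriv i j p \<equiv> (\<lambda>x. dirderiv (rot_field i j x) p x)"

text \<open>The flow of \<open>rot_field i j\<close>: for \<open>i \<noteq> j\<close>, the rotation
  by the angle \<open>t\<close> in the plane of the two axes. Writing it as the identity plus two
  corrections makes linearity and the derivative in \<open>t\<close> immediate.\<close>

definition rotation :: "'n \<Rightarrow> 'n \<Rightarrow> real \<Rightarrow> real^'n \<Rightarrow> real^'n" where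
  "rotation i j t x = x + ((cos t - 1) * x$i - sin t * x$j) *\<^sub>R axis i 1
      + (sin t * x$i + (cos t - 1) * x$j) *\<^sub>R axis j 1"

lemma rot_deriv_eq:
  assumes "real_polynomial_function p"
  shows "rot_deriv i j p x = x$i * dirderiv (axis j 1) p x - x$j * dirderiv (axis i 1) p x"
proof -
  interpret bounded_linear "\<lambda>w. dirderiv w p x" by (rule dirderiv_linear_dir[OF assms])
  show ?thesis by (simp add: rot_field_def diff scaleR)
qed

lemma real_polynomial_vec_nth: "real_polynomial_function (\<lambda>x. x $ i)"
  by (simp add: real_polynomial_function.intros(1) bounded_linear_vec_nth)

lemma real_polynomial_rot_deriv:
  assumes "real_polynomial_function p"
  shows "real_polynomial_function (rot_deriv i j p)"
  using assms by (simp add: rot_deriv_eq[OF assms])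
    (intro real_polynomial_function_diff real_polynomial_function.intros(4) real_polynomial_vec_nth real_polynomial_dirderiv)

lemma orthogonal_rotation:
  assumes "i \<noteq> j"
  shows "orthogonal_transformation (rotation i j t)"
  unfolding orthogonal_transformation
proof (intro conjI allI)
  show "linear (rotation i j t)"
    by (rule linearI) (simp_all add: rotation_def algebra_simps scaleR_diff_left)
  fix v :: "real^'a"
  have 1: "axis i (1::real) $ j = 0" "axis j (1::real) $ i = 0" using assms by (auto simp: axis_def)
  define a where "a = v$i" define b where "b = v$j"
  have "(norm (rotation i j t v))\<^sup>2 = (norm v)\<^sup>2 + 2 * ((cos t - 1) * a - sin t * b) * a
     + 2 * (sin t * a + (cos t - 1) * b) * b + ((cos t - 1) * a - sin t * b)^2 + (sin t * a + (cos t - 1) * b)^2"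
    unfolding power2_norm_eq_inner rotation_def a_def b_def
    by (simp add: inner_add_left inner_add_right inner_axis inner_axis' 1 power2_eq_square algebra_simps inner_commute
       )
  also have "\<dots> = (norm v)\<^sup>2 + (a^2 + b^2) * ((sin t)^2 + (cos t)^2 - 1)"
    by algebra
  also have "\<dots> = (norm v)\<^sup>2" by simp
  finally show "norm (rotation i j t v) = norm v" by (simp add: power2_eq_iff_nonneg)
qed

lemma rotation_has_derivative:
  assumes "i \<noteq> j"
  shows "((\<lambda>t. rotation i j t x) has_vector_derivative rot_field i j (rotation i j t x)) (at t)"
proof -
  have "rot_field i j (rotation i j t x) = (- sin t * x$i - cos t * x$j) *\<^sub>R axis i 1
      + (cos t * x$i - sin t * x$j) *\<^sub>R axis j 1"
    using assms by (simp add: rot_field_def rotation_def axis_def algebra_simps)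
  then show ?thesis
    unfolding rotation_def by (auto intro!: derivative_eq_intros)
qed

text \<open>The integral of \<open>p\<close> over rotated points does not depend on the angle, and
  its derivative at angle zero is the integral in question. For \<open>i = j\<close> the field
  itself vanishes.\<close>

lemma integral_rot_deriv:
  fixes p :: "real^'n \<Rightarrow> real"
  assumes p: "real_polynomial_function p"
  shows "(LINT x|sphere_measure. rot_deriv i j p x) = 0"
proof (cases "i = j")
  case True
  then show ?thesis by (simp add: rot_deriv_eq[OF p])
next
  case ij: False
  define G where "G = rot_deriv i j p"
  \<comment> \<open>Difference quotients along the angles \<open>1 / real (Suc k)\<close>; a
    sequence of angles allows dominated convergence.\<close>
  define s where "s k x = (p (rotation i j (1 / real (Suc k)) x) - p x) * real (Suc k)" for k x
  note c = continuous_on_real_polynomial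
  have GP: "real_polynomial_function G" unfolding G_def by (rule real_polynomial_rot_deriv[OF p])
  have d: "((\<lambda>t. p (rotation i j t x)) has_real_derivative G (rotation i j t x)) (at t)" for t x
  proof -
    have sc: "dirderiv (c *\<^sub>R w) p y = c * dirderiv w p y" for c w y
      using linear_cmul[OF bounded_linear.linear[OF dirderiv_linear_dir[OF p]]] by simp
    from has_derivative_compose[OF rotation_has_derivative[OF ij, unfolded has_vector_derivative_def]
        real_polynomial_has_derivative[OF p], of x t]
    show ?thesis by (simp add: has_field_derivative_def G_def sc mult_commute_abs)
  qed
  have r0: "rotation i j 0 x = x" for x by (simp add: rotation_def)
  obtain B where B: "\<And>x. x \<in> unit_sphere \<Longrightarrow> \<bar>G x\<bar> \<le> B"
  proof -
    have "compact (G ` unit_sphere)" using c[OF GP] compact_continuous_image compact_sphere by blast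
    then obtain B where "\<forall>y\<in>G ` unit_sphere. norm y \<le> B" using compact_imp_bounded bounded_iff by blast
    then show ?thesis using that[of B] by simp
  qed
  have cr: "continuous_on A (rotation i j t)" for A t
    using orthogonal_rotation[OF ij] by (simp add: orthogonal_transformation_linear linear_continuous_on linear_linear)
  have nr: "norm (rotation i j t x) = norm x" for t x
    using orthogonal_rotation[OF ij] by (rule orthogonal_transformation_norm)
  have cpr: "continuous_on unit_sphere (\<lambda>x. p (rotation i j t x))" for t
    by (rule continuous_on_compose2[OF c[OF p] cr]) (auto simp: nr)
  have ms: "s k \<in> borel_measurable sphere_measure" for k
    unfolding s_def using cpr c[OF p] by (intro borel_measurable_sphere_measure continuous_intros)
  have "(\<lambda>k. LINT x|sphere_measure. s k x) \<longlonglongrightarrow> (LINT x|sphere_measure. G x)"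
  proof (rule integral_dominated_convergence[where w="\<lambda>_. B"])
    show "G \<in> borel_measurable sphere_measure" by (rule borel_measurable_sphere_measure[OF c[OF GP]])
    show "AE x in sphere_measure. (\<lambda>k. s k x) \<longlonglongrightarrow> G x"
    proof (rule AE_I2)
      fix x :: "real^'n"
      have "((\<lambda>t. (p (rotation i j (0 + t) x) - p (rotation i j 0 x)) / t) \<longlongrightarrow> G (rotation i j 0 x)) (at 0)"
        using d[of x 0] unfolding DERIV_def by simp
      moreover have "filterlim (\<lambda>k. 1 / real (Suc k)) (at 0) sequentially"
        using LIMSEQ_inverse_real_of_nat by (auto simp: filterlim_at divide_inverse)
      ultimately have "(\<lambda>k. (p (rotation i j (0 + 1 / real (Suc k)) x) - p (rotation i j 0 x)) / (1 / real (Suc k))) \<longlonglongrightarrow> G (rotation i j 0 x)"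
        by (rule filterlim_compose)
      then show "(\<lambda>k. s k x) \<longlonglongrightarrow> G x" by (simp add: s_def r0)
    qed
    fix k
    show "AE x in sphere_measure. norm (s k x) \<le> B"
    proof (rule AE_I2)
      fix x :: "real^'n" assume x: "x \<in> space sphere_measure"
      define T where "T = 1 / real (Suc k)"
      have T: "T > 0" by (simp add: T_def)
      \<comment> \<open>The mean value theorem makes the quotient a value of \<open>G\<close> at a
        rotated point. That point is still on the sphere, so \<open>B\<close> dominates all
        quotients.\<close>
      obtain z where "0 < z" "z < T" "p (rotation i j T x) - p (rotation i j 0 x) = (T - 0) * G (rotation i j z x)"
        using MVT2[OF T, of "\<lambda>t. p (rotation i j t x)" "\<lambda>t. G (rotation i j t x)"] d by blast
      then have "s k x = G (rotation i j z x)" by (simp add: s_def r0 T_def)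
      then show "norm (s k x) \<le> B" using B[of "rotation i j z x"] x by (simp add: nr)
    qed
  qed (use ms in auto)
  moreover have "(LINT x|sphere_measure. s k x) = 0" for k
    using integral_sphere_orthogonal[OF orthogonal_rotation[OF ij] c[OF p]]
      integrable_sphere_measure[OF cpr] integrable_sphere_measure[OF c[OF p]]
    by (simp add: s_def)
  ultimately show ?thesis using LIMSEQ_unique[of "\<lambda>k. 0::real"] by (simp add: G_def)
qed

lemma integrable_sphere_polynomial:
  "real_polynomial_function q \<Longrightarrow> integrable sphere_measure q"
  by (simp add: continuous_on_real_polynomial integrable_sphere_measure)

lemma integral_rot_deriv_skew:
  assumes p: "real_polynomial_function p" and q: "real_polynomial_function q"
  shows "(LINT x|sphere_measure. rot_deriv i j p x * q x) = - (LINT x|sphere_measure. p x * rot_deriv i j q x)"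
proof -
  have "(LINT x|sphere_measure. p x * rot_deriv i j q x + rot_deriv i j p x * q x) = 0"
    using integral_rot_deriv[OF real_polynomial_function.intros(4)[OF p q]] by (simp add: dirderiv_mult p q)
  moreover have "integrable sphere_measure (\<lambda>x. p x * rot_deriv i j q x)"
    "integrable sphere_measure (\<lambda>x. rot_deriv i j p x * q x)"
    by (intro integrable_sphere_polynomial real_polynomial_function.intros(4) real_polynomial_rot_deriv p q)+
  ultimately show ?thesis by simp
qed

section \<open>The energy of spherical harmonics\<close>

text \<open>The outer field also differentiates the coefficients of the inner one. This produces the
  first-order terms, which after summation bring the dimension into the eigenvalue.\<close>

lemma rot_deriv_square:
  fixes p :: "real^'n \<Rightarrow> real"
  assumes p: "real_polynomial_function p"
  defines "d \<equiv> \<lambda>i. dirderiv (axis i 1) p" and "h \<equiv> \<lambda>i j. dirderiv (axis i 1) (dirderiv (axis j 1) p)"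
  shows "rot_deriv i j (rot_deriv i j p) x =
    x$i * ((if i = j then d j x else 0) + x$i * h j j x) - x$i * (d i x + x$j * h j i x)
    - x$j * (d j x + x$i * h i j x) + x$j * ((if i = j then d i x else 0) + x$j * h i i x)"
proof -
  have q: "rot_deriv i j p = (\<lambda>x. x$i * d j x - x$j * d i x)"
    by (rule ext) (simp add: rot_deriv_eq[OF p] d_def)
  have P: "real_polynomial_function (\<lambda>x. x$i * d j x)" for i j
    unfolding d_def by (intro real_polynomial_function.intros(4) real_polynomial_vec_nth real_polynomial_dirderiv p)
  have dd: "dirderiv v (\<lambda>x. x$i * d j x - x$j * d i x) x =
      (x$i * dirderiv v (d j) x + v$i * d j x) - (x$j * dirderiv v (d i) x + v$j * d i x)" for v
  proof -
    have nth: "((\<lambda>x. x$i) has_derivative (\<lambda>v. v$i)) (at x)" for i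
      by (rule bounded_linear_imp_has_derivative[OF bounded_linear_vec_nth])
    have dr: "(d i has_derivative (\<lambda>v. dirderiv v (d i) x)) (at x)" for i
      unfolding d_def by (intro real_polynomial_has_derivative real_polynomial_dirderiv p)
    show ?thesis
      by (rule dirderivI) (intro has_derivative_diff has_derivative_mult nth dr)
  qed
  have "real_polynomial_function (\<lambda>x. x$i * d j x - x$j * d i x)" by (intro real_polynomial_function_diff P)
  from rot_deriv_eq[OF this, of i j x]
  have *: "rot_deriv i j (rot_deriv i j p) x =
      x$i * ((x$i * h j j x + axis j 1 $ i * d j x) - (x$j * h j i x + axis j 1 $ j * d i x))
    - x$j * ((x$i * h i j x + axis i 1 $ i * d j x) - (x$j * h i i x + axis i 1 $ j * d i x))"
    unfolding q dd unfolding h_def d_def .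
  have ax: "axis a (1::real) $ b = (if a = b then 1 else 0)" for a b :: 'n by (simp add: axis_def)
  show ?thesis unfolding * ax by (simp add: algebra_simps)
qed

definition sphere_eigenvalue :: "'n itself \<Rightarrow> nat \<Rightarrow> real" where
  "sphere_eigenvalue _ l = real l * (real l + real CARD('n) - 2)"

text \<open>On the unit sphere, the Laplace--Beltrami operator is half of the sum of the squares of
  all \<open>rot_deriv i j\<close>.\<close>

lemma sum_rot_deriv_square:
  fixes p :: "real^'n \<Rightarrow> real"
  assumes "harmonic_form l p"
  shows "(\<Sum>i\<in>UNIV. \<Sum>j\<in>UNIV. rot_deriv i j (rot_deriv i j p) x)
    = - 2 * sphere_eigenvalue TYPE('n) l * p x"
proof -
  have p: "real_polynomial_function p" and E: "\<And>x. dirderiv x p x = real l * p x"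
    and L: "(\<Sum>i\<in>UNIV. dirderiv (axis i 1) (dirderiv (axis i 1) p) x) = 0"
    using assms by (auto simp: harmonic_form_def)
  define a where "a i = x$i" for i
  define d where "d i = dirderiv (axis i 1) p x" for i
  define h where "h i j = dirderiv (axis i 1) (dirderiv (axis j 1) p) x" for i j
  have sym: "h i j = h j i" for i j unfolding h_def by (metis dirderiv_commute[OF p])
  have H0: "(\<Sum>i\<in>UNIV. h i i) = 0" using L by (simp add: h_def)
  have E1: "(\<Sum>i\<in>UNIV. a i * d i) = real l * p x"
    using E[of x] dirderiv_axis_expand[OF p, of x x] by (simp add: a_def d_def)
  have E2: "(\<Sum>i\<in>UNIV. a i * h i j) = (real l - 1) * d j" for j
    using euler_dirderiv[OF p E, of x "axis j 1"] dirderiv_axis_expand[OF real_polynomial_dirderiv[OF p], of x "axis j 1" x]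
    by (simp add: a_def d_def h_def)
  have E2': "(\<Sum>j\<in>UNIV. a j * h i j) = (real l - 1) * d i" for i
    using E2[of i] by (simp add: sym)
  have R: "rot_deriv i j (rot_deriv i j p) x = (if i = j then 2 * (a i * d i) else 0) + a i * a i * h j j + a j * a j * h i i
     - a i * d i - a j * d j - 2 * (a i * (a j * h i j))" for i j
    unfolding rot_deriv_square[OF p] using sym[of i j] by (simp add: a_def d_def h_def algebra_simps)
  have "(\<Sum>i\<in>UNIV. \<Sum>j\<in>UNIV. rot_deriv i j (rot_deriv i j p) x) =
     (\<Sum>i\<in>UNIV. 2 * (a i * d i)) + (\<Sum>i\<in>UNIV. a i * a i) * (\<Sum>j\<in>UNIV. h j j) + (\<Sum>j\<in>UNIV. a j * a j) * (\<Sum>i\<in>UNIV. h i i)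
     - CARD('n) * (\<Sum>i\<in>UNIV. a i * d i) - CARD('n) * (\<Sum>j\<in>UNIV. a j * d j) - 2 * (\<Sum>i\<in>UNIV. a i * (\<Sum>j\<in>UNIV. a j * h i j))"
  proof -
    have e0: "(\<Sum>i\<in>UNIV. \<Sum>j\<in>UNIV. rot_deriv i j (rot_deriv i j p) x) =
       (\<Sum>i\<in>UNIV. 2 * (a i * d i)) + (\<Sum>i\<in>UNIV. \<Sum>j\<in>UNIV. a i * a i * h j j) + (\<Sum>i\<in>UNIV. \<Sum>j\<in>UNIV. a j * a j * h i i)
       - (\<Sum>i\<in>UNIV. \<Sum>j\<in>(UNIV::'n set). a i * d i) - (\<Sum>i\<in>(UNIV::'n set). \<Sum>j\<in>UNIV. a j * d j)
       - (\<Sum>i\<in>UNIV. \<Sum>j\<in>UNIV. 2 * (a i * (a j * h i j)))"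
      unfolding R by (simp add: sum.distrib sum_subtractf)
    have e1: "(\<Sum>i\<in>UNIV. \<Sum>j\<in>UNIV. a j * a j * h i i) = (\<Sum>j\<in>UNIV. a j * a j) * (\<Sum>i\<in>UNIV. h i i)"
      unfolding sum_product by (rule sum.swap)
    have e2: "(\<Sum>i\<in>UNIV. \<Sum>j\<in>UNIV. a i * a i * h j j) = (\<Sum>i\<in>UNIV. a i * a i) * (\<Sum>j\<in>UNIV. h j j)"
      by (rule sum_product[symmetric])
    have e3: "(\<Sum>i\<in>UNIV. \<Sum>j\<in>UNIV. 2 * (a i * (a j * h i j))) = 2 * (\<Sum>i\<in>UNIV. a i * (\<Sum>j\<in>UNIV. a j * h i j))"
      by (simp add: sum_distrib_left)
    show ?thesis
      unfolding e0 e1 e2 e3 by (simp add: sum_distrib_left)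
  qed
  \<comment> \<open>Both sums of squared coordinates are multiplied by the Laplacian of
    \<open>p\<close>, which is zero; so the identity holds off the sphere as well.\<close>
  also have "\<dots> = 2 * (real l * p x) - 2 * CARD('n) * (real l * p x) - 2 * ((real l - 1) * (\<Sum>i\<in>UNIV. a i * d i))"
    unfolding H0 E2' by (simp add: E1 sum_distrib_left[symmetric] mult.left_commute[of _ "real l - 1"])
  also have "\<dots> = - 2 * sphere_eigenvalue TYPE('n) l * p x"
    unfolding E1 sphere_eigenvalue_def by (simp add: algebra_simps)
  finally show ?thesis .
qed

lemma harmonic_form_polynomial: "harmonic_form l p \<Longrightarrow> real_polynomial_function p"
  by (simp add: harmonic_form_def)

text \<open>Green's formula, by moving one field across with skew-symmetry. The factor 2 counts each
  coordinate plane twice, as \<open>(i, j)\<close> and as \<open>(j, i)\<close>. With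
  \<open>q\<close> of another degree this gives orthogonality, with \<open>q = p\<close> the
  energy.\<close>

lemma integral_rot_deriv_harmonic:
  fixes p q :: "real^'n \<Rightarrow> real"
  assumes "harmonic_form l p" and q: "real_polynomial_function q"
  shows "(\<Sum>i\<in>UNIV. \<Sum>j\<in>UNIV. LINT x|sphere_measure. rot_deriv i j p x * rot_deriv i j q x)
    = 2 * sphere_eigenvalue TYPE('n) l * (LINT x|sphere_measure. p x * q x)"
proof -
  note p = harmonic_form_polynomial[OF assms(1)]
  note r = real_polynomial_rot_deriv
  have i: "integrable sphere_measure (\<lambda>x. rot_deriv i j (rot_deriv i j p) x * q x)" for i j
    by (intro integrable_sphere_polynomial real_polynomial_function.intros(4) r p q)
  have "(LINT x|sphere_measure. rot_deriv i j p x * rot_deriv i j q x)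
     = - (LINT x|sphere_measure. rot_deriv i j (rot_deriv i j p) x * q x)" for i j
    using integral_rot_deriv_skew[OF r[OF p] q, of i j] by simp
  then have "(\<Sum>i\<in>UNIV. \<Sum>j\<in>UNIV. LINT x|sphere_measure. rot_deriv i j p x * rot_deriv i j q x)
     = - (LINT x|sphere_measure. (\<Sum>i\<in>UNIV. \<Sum>j\<in>UNIV. rot_deriv i j (rot_deriv i j p) x) * q x)"
    using i by (simp add: sum_distrib_right sum_negf)
  also have "\<dots> = 2 * sphere_eigenvalue TYPE('n) l * (LINT x|sphere_measure. p x * q x)"
    by (simp add: sum_rot_deriv_square[OF assms(1)] mult.assoc)
  finally show ?thesis .
qed

text \<open>The energy form is symmetric, so it can be evaluated with the eigenvalue of either
  factor; distinct degrees have distinct eigenvalues.\<close>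

lemma harmonic_forms_orthogonal:
  fixes p q :: "real^'n \<Rightarrow> real"
  assumes n: "CARD('n) \<ge> 2" and p: "harmonic_form l p" and q: "harmonic_form m q" and "l \<noteq> m"
  shows "(LINT x|sphere_measure. p x * q x) = 0"
proof -
  have "sphere_eigenvalue TYPE('n) l * (LINT x|sphere_measure. p x * q x)
      = sphere_eigenvalue TYPE('n) m * (LINT x|sphere_measure. p x * q x)"
    using integral_rot_deriv_harmonic[OF p harmonic_form_polynomial[OF q]]
      integral_rot_deriv_harmonic[OF q harmonic_form_polynomial[OF p]]
    by (simp add: mult.commute)
  \<comment> \<open>This is where the dimension enters: with \<open>n \<ge> 2\<close> and
    \<open>b > 0\<close> the second factor below is positive.\<close>
  moreover have "sphere_eigenvalue TYPE('n) a < sphere_eigenvalue TYPE('n) b" if "a < b" for a b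
  proof -
    have "sphere_eigenvalue TYPE('n) b - sphere_eigenvalue TYPE('n) a
        = (real b - real a) * (real b + real a + (real CARD('n) - 2))"
      by (simp add: sphere_eigenvalue_def algebra_simps)
    also have "\<dots> > 0" using that n by (intro mult_pos_pos) auto
    finally show ?thesis by simp
  qed
  then have "sphere_eigenvalue TYPE('n) l \<noteq> sphere_eigenvalue TYPE('n) m"
    using \<open>l \<noteq> m\<close> by (metis less_irrefl linorder_neqE_nat)
  ultimately show ?thesis by simp
qed

definition gradient :: "(real^'n \<Rightarrow> real) \<Rightarrow> real^'n \<Rightarrow> real^'n" where
  "gradient p x = (\<chi> i. dirderiv (axis i 1) p x)"

text \<open>For \<open>norm x = 1\<close> this is the orthogonal projection of the Euclidean
  gradient onto the tangent space; elsewhere the formula has no such meaning.\<close>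

definition sphere_gradient :: "(real^'n \<Rightarrow> real) \<Rightarrow> real^'n \<Rightarrow> real^'n" where
  "sphere_gradient p x = gradient p x - (x \<bullet> gradient p x) *\<^sub>R x"

lemma continuous_on_sphere_gradient:
  assumes "real_polynomial_function p"
  shows "continuous_on S (sphere_gradient p)"
  unfolding sphere_gradient_def gradient_def
  by (intro continuous_intros continuous_on_vec_lambda continuous_on_real_polynomial real_polynomial_dirderiv assms)

text \<open>Lagrange's identity: the double sum is twice the Gram determinant of \<open>x\<close>
  and the Euclidean gradient, and for a unit vector \<open>x\<close> this determinant is the squared
  length of the tangential part.\<close>

lemma norm_sphere_gradient:
  fixes p :: "real^'n \<Rightarrow> real"
  assumes p: "real_polynomial_function p" and x: "norm x = 1"
  shows "(norm (sphere_gradient p x))\<^sup>2 = (\<Sum>i\<in>UNIV. \<Sum>j\<in>UNIV. (rot_deriv i j p x)\<^sup>2) / 2"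
proof -
  define d where "d = gradient p x"
  have xx: "x \<bullet> x = 1" using x by (simp add: dot_square_norm)
  have "(\<Sum>i\<in>UNIV. \<Sum>j\<in>UNIV. (rot_deriv i j p x)\<^sup>2) = (\<Sum>i\<in>UNIV. \<Sum>j\<in>UNIV. (x$i * d$j - x$j * d$i)^2)"
    by (simp add: rot_deriv_eq[OF p] d_def gradient_def)
  also have "\<dots> = (\<Sum>i\<in>UNIV. \<Sum>j\<in>UNIV. (x$i*x$i) * (d$j*d$j)) + (\<Sum>i\<in>UNIV. \<Sum>j\<in>UNIV. (d$i*d$i) * (x$j*x$j))
      - 2 * (\<Sum>i\<in>UNIV. \<Sum>j\<in>UNIV. (x$i*d$i) * (x$j*d$j))"
    by (simp add: power2_eq_square algebra_simps sum.distrib sum_subtractf sum_distrib_left)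
  also have "\<dots> = 2 * (x \<bullet> x) * (d \<bullet> d) - 2 * (x \<bullet> d)^2"
    by (simp add: sum_product[symmetric] inner_vec_def power2_eq_square)
  finally have "(\<Sum>i\<in>UNIV. \<Sum>j\<in>UNIV. (rot_deriv i j p x)\<^sup>2) = 2 * (d \<bullet> d - (x \<bullet> d)^2)" by (simp add: xx)
  moreover have "(norm (sphere_gradient p x))\<^sup>2 = d \<bullet> d - (x \<bullet> d)^2"
    unfolding power2_norm_eq_inner sphere_gradient_def d_def[symmetric]
    by (simp add: inner_diff_left inner_diff_right xx inner_commute power2_eq_square)
  ultimately show ?thesis by simp
qed

lemma integral_norm_sphere_gradient:
  fixes p :: "real^'n \<Rightarrow> real"
  assumes "harmonic_form l p"
  shows "(LINT x|sphere_measure. (norm (sphere_gradient p x))\<^sup>2)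
    = sphere_eigenvalue TYPE('n) l * (LINT x|sphere_measure. (p x)\<^sup>2)"
proof -
  note p = harmonic_form_polynomial[OF assms]
  have i: "integrable sphere_measure (\<lambda>x. (rot_deriv i j p x)\<^sup>2)" for i j
    by (intro integrable_sphere_polynomial real_polynomial_function_power real_polynomial_rot_deriv p)
  have "(LINT x|sphere_measure. (norm (sphere_gradient p x))\<^sup>2)
     = (LINT x|sphere_measure. (\<Sum>i\<in>UNIV. \<Sum>j\<in>UNIV. (rot_deriv i j p x)\<^sup>2) / 2)"
    by (rule Bochner_Integration.integral_cong) (auto simp: norm_sphere_gradient[OF p])
  also have "\<dots> = (\<Sum>i\<in>UNIV. \<Sum>j\<in>UNIV. LINT x|sphere_measure. (rot_deriv i j p x)\<^sup>2) / 2"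
    using i by simp
  also have "\<dots> = sphere_eigenvalue TYPE('n) l * (LINT x|sphere_measure. (p x)\<^sup>2)"
    using integral_rot_deriv_harmonic[OF assms p] by (simp add: power2_eq_square)
  finally show ?thesis .
qed

section \<open>The number of independent spherical harmonics\<close>

text \<open>Gaussian elimination for a homogeneous system with more unknowns than equations, one
  equation for each induction step.\<close>

lemma nontrivial_solution:
  fixes A :: "'m \<Rightarrow> 'b \<Rightarrow> real"
  assumes "finite M" "finite B" "card M < card B"
  shows "\<exists>c. (\<exists>b\<in>B. c b \<noteq> 0) \<and> (\<forall>m\<in>M. (\<Sum>b\<in>B. c b * A m b) = 0)"
  using assms
proof (induction M arbitrary: A B rule: finite_induct)
  case empty
  then show ?case by (intro exI[of _ "\<lambda>_. 1"]) (auto simp: card_gt_0_iff)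
next
  case (insert m M)
  show ?case
  proof (cases "\<forall>b\<in>B. A m b = 0")
    case True
    then show ?thesis using insert.IH[of B A] insert.prems insert.hyps by auto
  next
    case False
    then obtain b0 where b0: "b0 \<in> B" "A m b0 \<noteq> 0" by blast
    \<comment> \<open>Equation \<open>m\<close> is solved for the unknown \<open>b0\<close> and
      substituted into the others. Row \<open>m\<close> of \<open>A'\<close> is zero by
      construction, which settles equation \<open>m\<close> itself.\<close>
    define A' where "A' k b = A k b - A m b / A m b0 * A k b0" for k b
    have "card M < card (B - {b0})" using insert.prems insert.hyps b0 by simp
    then obtain c where c: "\<exists>b\<in>B - {b0}. c b \<noteq> 0" "\<forall>k\<in>M. (\<Sum>b\<in>B - {b0}. c b * A' k b) = 0"
      using insert.IH[of "B - {b0}" A'] insert.prems by auto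
    define c' where "c' = c(b0 := - (\<Sum>b\<in>B - {b0}. c b * (A m b / A m b0)))"
    have "(\<Sum>b\<in>B. c' b * A k b) = (\<Sum>b\<in>B - {b0}. c b * A' k b)" for k
    proof -
      have "(\<Sum>b\<in>B. c' b * A k b) = c' b0 * A k b0 + (\<Sum>b\<in>B - {b0}. c' b * A k b)"
        using b0 insert.prems by (simp add: sum.remove)
      also have "(\<Sum>b\<in>B - {b0}. c' b * A k b) = (\<Sum>b\<in>B - {b0}. c b * A k b)"
        by (intro sum.cong) (auto simp: c'_def)
      finally show ?thesis
        by (simp add: c'_def A'_def right_diff_distrib sum_subtractf sum_distrib_right mult.assoc)
    qed
    moreover have "A' m b = 0" for b using b0 by (simp add: A'_def)
    moreover have "\<exists>b\<in>B. c' b \<noteq> 0" using c(1) by (auto simp: c'_def)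
    ultimately show ?thesis using c(2) by (intro exI[of _ c']) auto
  qed
qed

text \<open>The restriction to polynomials makes these operators commute on all functions.\<close>

definition poly_deriv :: "'n \<Rightarrow> (real^'n \<Rightarrow> real) \<Rightarrow> real^'n \<Rightarrow> real" where
  "poly_deriv i p = (if real_polynomial_function p then dirderiv (axis i 1) p else p)"

lemma poly_deriv_commute: "poly_deriv i (poly_deriv j p) = poly_deriv j (poly_deriv i p)"
  using dirderiv_commute[of p "axis i 1" "axis j 1"] by (simp add: poly_deriv_def real_polynomial_dirderiv)

text \<open>A multiset of axes serves as a multi-index: \<open>count M i\<close> is the number of
  derivatives in direction \<open>i\<close>, and \<open>size M\<close> is the order.\<close>

definition multi_deriv :: "'n multiset \<Rightarrow> (real^'n \<Rightarrow> real) \<Rightarrow> real^'n \<Rightarrow> real" where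
  "multi_deriv M p = fold_mset poly_deriv p M"

interpretation poly_deriv: comp_fun_commute "poly_deriv :: 'n \<Rightarrow> (real^'n \<Rightarrow> real) \<Rightarrow> _"
  by standard (auto simp: poly_deriv_commute)

lemma multi_deriv_empty [simp]: "multi_deriv {#} p = p"
  by (simp add: multi_deriv_def)

lemma multi_deriv_add_mset:
  "multi_deriv (add_mset i M) p = multi_deriv M (poly_deriv i p)"
  by (simp add: multi_deriv_def poly_deriv.fold_mset_fun_left_comm)

lemma multi_deriv_sum:
  fixes p :: "'b \<Rightarrow> real^'n \<Rightarrow> real"
  assumes "finite B" "\<And>b. b \<in> B \<Longrightarrow> real_polynomial_function (p b)"
  shows "multi_deriv M (\<lambda>x. \<Sum>b\<in>B. c b * p b x) x = (\<Sum>b\<in>B. c b * multi_deriv M (p b) x)"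
  using assms(2)
proof (induction M arbitrary: p)
  case empty then show ?case by simp
next
  case (add i M)
  have q: "real_polynomial_function (\<lambda>x. c b * p b x)" if "b \<in> B" for b using add.prems[OF that] by auto
  then have "real_polynomial_function (\<lambda>x. \<Sum>b\<in>B. c b * p b x)" using assms(1) by auto
  then have "poly_deriv i (\<lambda>x. \<Sum>b\<in>B. c b * p b x) = (\<lambda>x. \<Sum>b\<in>B. c b * poly_deriv i (p b) x)"
    using add.prems assms(1) q by (simp add: poly_deriv_def dirderiv_sum dirderiv_cmult)
  then show ?case
    using add.IH[of "\<lambda>b. poly_deriv i (p b)"] add.prems
    by (simp add: multi_deriv_add_mset poly_deriv_def real_polynomial_dirderiv)
qed

text \<open>Cauchy data: modulo the Laplace equation, second derivatives in the direction \<open>i0\<close> can be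
  expressed through the others.\<close>

lemma harmonic_form_eq_0:
  fixes p :: "real^'n \<Rightarrow> real"
  assumes "harmonic_form l p"
    and "\<And>M. size M = l \<Longrightarrow> count M i0 \<le> 1 \<Longrightarrow> multi_deriv M p 0 = 0"
  shows "p x = 0"
  using assms
proof (induction l arbitrary: p x)
  case 0
  have "dirderiv x p x = 0" for x using 0(1) by (simp add: harmonic_form_def)
  then have "p x = p 0" by (rule homogeneous_degree_zero[OF harmonic_form_polynomial[OF 0(1)]])
  also have "\<dots> = 0" using 0(2)[of "{#}"] by simp
  finally show ?case .
next
  case (Suc l)
  note p = harmonic_form_polynomial[OF Suc.prems(1)]
  have E: "dirderiv x p x = real (Suc l) * p x" for x using Suc.prems(1) by (simp add: harmonic_form_def)
  have pd: "poly_deriv i p = dirderiv (axis i 1) p" for i by (simp add: poly_deriv_def p)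
  have H: "harmonic_form l (dirderiv (axis i 1) p)" for i by (rule harmonic_form_dirderiv[OF Suc.prems(1)])
  \<comment> \<open>Adding an axis other than \<open>i0\<close> leaves \<open>count M i0\<close>
    unchanged, so these derivatives inherit vanishing Cauchy data and the induction hypothesis
    applies.\<close>
  have off: "dirderiv (axis i 1) p = (\<lambda>x. 0)" if "i \<noteq> i0" for i
  proof (rule ext)
    fix x show "dirderiv (axis i 1) p x = 0"
    proof (rule Suc.IH[OF H])
      fix M :: "'n multiset" assume "size M = l" "count M i0 \<le> 1"
      then show "multi_deriv M (dirderiv (axis i 1) p) 0 = 0"
        using Suc.prems(2)[of "add_mset i M"] that by (simp add: multi_deriv_add_mset pd)
    qed
  qed
  define q where "q = dirderiv (axis i0 1) p"
  have Q: "real_polynomial_function q" unfolding q_def by (rule real_polynomial_dirderiv[OF p])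
  have "dirderiv (axis i 1) q x = 0" for i x
  proof (cases "i = i0")
    case False
    then show ?thesis unfolding q_def dirderiv_commute[OF p, of "axis i 1"] by (simp add: off)
  next
    case True
    \<comment> \<open>All other pure second derivatives vanish by \<open>off\<close>, so the Laplace
      equation forces the one in direction \<open>i0\<close> to vanish too.\<close>
    have "(\<Sum>i\<in>UNIV. dirderiv (axis i 1) (dirderiv (axis i 1) p) x) = 0"
      using Suc.prems(1) by (simp add: harmonic_form_def)
    moreover have "(\<Sum>i\<in>UNIV. dirderiv (axis i 1) (dirderiv (axis i 1) p) x) = (\<Sum>i\<in>{i0}. dirderiv (axis i 1) (dirderiv (axis i 1) p) x)"
      by (rule sum.mono_neutral_right) (auto simp: off)
    ultimately show ?thesis using True by (simp add: q_def)
  qed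
  then have Dq: "dirderiv v q x = 0" for v x by (simp add: dirderiv_axis_expand[OF Q, of v])
  have "q x = 0" for x
  \<comment> \<open>In degree 0 Euler's identity says nothing about the constant \<open>q\<close>;
    its value is the Cauchy datum of \<open>{#i0#}\<close>. In positive degree the identity turns
    vanishing derivatives into \<open>q = 0\<close>.\<close>
  proof (cases l)
    case 0
    have "q x = q 0" by (rule homogeneous_degree_zero[OF Q]) (rule Dq)
    also have "\<dots> = 0" using Suc.prems(2)[of "{#i0#}"] 0 by (simp add: multi_deriv_add_mset pd q_def)
    finally show ?thesis .
  next
    case (Suc k)
    then show ?thesis using H[of i0] Dq[of x x] by (simp add: harmonic_form_def q_def)
  qed
  then have "dirderiv (axis i 1) p = (\<lambda>x. 0)" for i using off[of i] by (cases "i = i0") (auto simp: q_def)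
  then have "dirderiv x p x = 0" by (simp add: dirderiv_axis_expand[OF p, of x])
  then show ?case using E[of x] by simp
qed

text \<open>At fixed size, a multiset is determined by its counts away from one index
  \<open>i1\<close>. This leaves two values at \<open>i0\<close> and at most \<open>l + 1\<close>
  values at each of the other \<open>n - 2\<close> indices; \<open>n \<ge> 2\<close> provides some
  \<open>i1 \<noteq> i0\<close>.\<close>

lemma card_multisets_le:
  fixes i0 :: "'n::finite"
  assumes "CARD('n) \<ge> 2"
  shows "finite {M. size M = l \<and> count M i0 \<le> 1}"
    and "card {M. size M = l \<and> count M i0 \<le> 1} \<le> 2 * (l + 1) ^ (CARD('n) - 2)"
proof -
  let ?S = "{M :: 'n multiset. size M = l \<and> count M i0 \<le> 1}"
  have "\<exists>i1. i1 \<noteq> i0"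
  proof (rule ccontr)
    assume "\<not> ?thesis" then have "UNIV = {i0}" by auto
    then have "CARD('n) = card {i0}" by (rule arg_cong)
    then show False using assms by simp
  qed
  then obtain i1 where i1: "i1 \<noteq> i0" by blast
  let ?R = "UNIV - {i0, i1}"
  let ?F = "\<lambda>M. (count M i0, restrict (count M) ?R)"
  let ?T = "{..1::nat} \<times> (?R \<rightarrow>\<^sub>E {..l})"
  have sz: "size M = (\<Sum>i\<in>UNIV. count M i)" for M :: "'n multiset"
    unfolding size_multiset_overloaded_eq by (rule sum.mono_neutral_left) (auto simp: not_in_iff)
  have im: "?F ` ?S \<subseteq> ?T"
    by (auto simp: restrict_def count_le_size split: if_splits)
  have inj: "inj_on ?F ?S"
  proof (rule inj_onI)
    fix M N assume M: "M \<in> ?S" and N: "N \<in> ?S" and eq: "?F M = ?F N"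
    have r: "count M i = count N i" if "i \<noteq> i1" for i
    proof (cases "i = i0")
      case False
      have "restrict (count M) ?R i = restrict (count N) ?R i" using eq by simp
      with False that show ?thesis by simp
    qed (use eq in simp)
    have "size K = count K i1 + (\<Sum>i\<in>UNIV - {i1}. count K i)" for K :: "'n multiset"
      unfolding sz by (simp add: sum.remove[of UNIV i1])
    moreover have "(\<Sum>i\<in>UNIV - {i1}. count M i) = (\<Sum>i\<in>UNIV - {i1}. count N i)"
      by (intro sum.cong) (auto simp: r)
    ultimately have "count M i1 = count N i1" using M N by simp
    with r show "M = N" by (metis multiset_eqI)
  qed
  have fT: "finite ?T" by (intro finite_cartesian_product finite_PiE) auto
  have "card ?R = CARD('n) - 2" using i1 by (simp add: card_Diff_subset)
  then have cT: "card ?T = 2 * (l + 1) ^ (CARD('n) - 2)"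
    by (simp add: card_cartesian_product card_PiE)
  show "finite ?S" using inj_on_finite[OF inj im fT] .
  show "card ?S \<le> 2 * (l + 1) ^ (CARD('n) - 2)" using card_inj_on_le[OF inj im fT] cT by simp
qed

lemma harmonic_onb_forms:
  assumes "harmonic_onb l B"
  obtains P where "\<And>f. f \<in> B \<Longrightarrow> harmonic_form l (P f)"
    "\<And>f x. f \<in> B \<Longrightarrow> norm x = 1 \<Longrightarrow> f x = P f x"
proof -
  have "\<forall>f\<in>B. \<exists>p. harmonic_form l p \<and> (\<forall>x. norm x = 1 \<longrightarrow> f x = p x)"
    using assms spherical_harmonic_form unfolding harmonic_onb_def by metis
  then show ?thesis using that by metis
qed

text \<open>With more basis elements than Cauchy data, some nontrivial combination would have zero
  data and hence vanish identically, against orthonormality.\<close>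

lemma card_harmonic_onb_le:
  fixes B :: "(real^'n \<Rightarrow> real) set"
  assumes n: "CARD('n) \<ge> 2" and B: "harmonic_onb l B"
  shows "card B \<le> 2 * (l + 1) ^ (CARD('n) - 2)"
proof (rule ccontr)
  assume less: "\<not> ?thesis"
  obtain i0 :: 'n where True by simp
  let ?S = "{M :: 'n multiset. size M = l \<and> count M i0 \<le> 1}"
  have fB: "finite B" using B by (simp add: harmonic_onb_def)
  obtain P where P: "\<And>f. f \<in> B \<Longrightarrow> harmonic_form l (P f)" "\<And>f x. f \<in> B \<Longrightarrow> norm x = 1 \<Longrightarrow> f x = P f x"
    using harmonic_onb_forms[OF B] by blast
  have "card ?S < card B" using card_multisets_le(2)[OF n, of l i0] less by simp
  then obtain c where c: "\<exists>b\<in>B. c b \<noteq> 0" "\<forall>M\<in>?S. (\<Sum>b\<in>B. c b * multi_deriv M (P b) 0) = 0"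
    using nontrivial_solution[OF card_multisets_le(1)[OF n] fB, of l i0 "\<lambda>M b. multi_deriv M (P b) 0"] by blast
  have 0: "(\<Sum>b\<in>B. c b * P b x) = 0" for x
  proof (rule harmonic_form_eq_0[of l _ i0])
    show "harmonic_form l (\<lambda>x. \<Sum>b\<in>B. c b * P b x)" by (rule harmonic_form_sum[OF fB P(1)])
    fix M :: "'n multiset" assume "size M = l" "count M i0 \<le> 1"
    then show "multi_deriv M (\<lambda>x. \<Sum>b\<in>B. c b * P b x) 0 = 0"
      using c(2) by (subst multi_deriv_sum[OF fB]) (auto intro: harmonic_form_polynomial[OF P(1)])
  qed
  obtain g where g: "g \<in> B" "c g \<noteq> 0" using c(1) by blast
  have i: "integrable sphere_measure (\<lambda>x. f x * g x)" if "f \<in> B" for f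
  proof -
    have "integrable sphere_measure (\<lambda>x. P f x * P g x)"
      using P(1) that g(1) by (intro integrable_sphere_polynomial real_polynomial_function.intros(4) harmonic_form_polynomial[of l]) auto
    then show ?thesis
      using that g(1) P(2) by (subst Bochner_Integration.integrable_cong[OF refl]) auto
  qed
  have "0 = (LINT x|sphere_measure. (\<Sum>f\<in>B. c f * f x) * g x)"
  proof -
    have "(\<Sum>f\<in>B. c f * f x) = 0" if "norm x = 1" for x
    proof -
      have "(\<Sum>f\<in>B. c f * f x) = (\<Sum>f\<in>B. c f * P f x)"
        by (intro sum.cong refl arg_cong2[where f="(*)"] P(2) that)
      then show ?thesis by (simp add: 0)
    qed
    then have "(LINT x|sphere_measure. (\<Sum>f\<in>B. c f * f x) * g x) = (LINT x|(sphere_measure :: (real^'n) measure). 0)"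
      by (intro Bochner_Integration.integral_cong) auto
    then show ?thesis by simp
  qed
  also have "\<dots> = (\<Sum>f\<in>B. c f * (LINT x|sphere_measure. f x * g x))"
    using i by (simp add: sum_distrib_right mult.assoc)
  also have "\<dots> = (\<Sum>f\<in>B. if f = g then c f else 0)"
    using B g(1) by (intro sum.cong) (auto simp: harmonic_onb_def)
  also have "\<dots> = c g" using g(1) fB by simp
  finally show False using g(2) by simp
qed

section \<open>Zonal harmonics on the diagonal\<close>

lemma dirderiv_compose_linear:
  fixes T :: "real^'n \<Rightarrow> real^'n"
  assumes p: "real_polynomial_function p" and T: "linear T"
  shows "dirderiv v (\<lambda>x. p (T x)) = (\<lambda>x. dirderiv (T v) p (T x))"
proof (rule ext, rule dirderivI)
  fix x
  have "(T has_derivative T) (at x)" using T by (simp add: linear_imp_has_derivative)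
  from has_derivative_compose[OF this real_polynomial_has_derivative[OF p]]
  show "((\<lambda>x. p (T x)) has_derivative (\<lambda>v. dirderiv (T v) p (T x))) (at x)" .
qed

lemma real_polynomial_compose_linear:
  fixes T :: "real^'n \<Rightarrow> real^'n"
  assumes p: "real_polynomial_function p" and T: "linear T"
  shows "real_polynomial_function (\<lambda>x. p (T x))"
proof -
  have "polynomial_function T"
    using T by (simp add: linear_conv_bounded_linear polynomial_function_bounded_linear)
  from real_polynomial_function_compose[OF this p] show ?thesis by (simp add: o_def)
qed

lemma laplacian_orthogonal:
  fixes T :: "real^'n \<Rightarrow> real^'n"
  assumes p: "real_polynomial_function p" and T: "orthogonal_transformation T"
  shows "laplacian (\<lambda>x. p (T x)) x = laplacian p (T x)"
proof -
  have lin: "linear T" using T by (rule orthogonal_transformation_linear)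
  note P1 = real_polynomial_dirderiv[OF p]
  have T': "orthogonal_transformation (inv T)" by (rule orthogonal_transformation_inv[OF T])
  have adj: "T u $ j = u \<bullet> inv T (axis j 1)" for u j
  proof -
    have "T u \<bullet> T (inv T (axis j 1)) = u \<bullet> inv T (axis j 1)"
      using T by (simp add: orthogonal_transformation_def)
    then show ?thesis by (simp add: surj_f_inv_f orthogonal_transformation_surj[OF T] inner_axis)
  qed
  \<comment> \<open>Row \<open>j\<close> of \<open>T\<close> is \<open>inv T (axis j 1)\<close>, and
    \<open>inv T\<close> is orthogonal, so the rows are orthonormal. This collapses the double sum
    of second derivatives to the trace.\<close>
  have delta: "(\<Sum>i\<in>UNIV. T (axis i 1) $ j * T (axis i 1) $ k) = (if j = k then 1 else 0)" for j k
  proof -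
    have "(\<Sum>i\<in>UNIV. T (axis i 1) $ j * T (axis i 1) $ k) = inv T (axis j (1::real)) \<bullet> inv T (axis k 1)"
      by (simp add: adj inner_axis' inner_vec_def[of "inv T (axis j 1)"])
    also have "\<dots> = axis j (1::real) \<bullet> axis k 1" using T' by (simp add: orthogonal_transformation_def)
    finally show ?thesis by (simp add: inner_axis_axis)
  qed
  have exp2: "dirderiv v (dirderiv v p) y
      = (\<Sum>j\<in>UNIV. \<Sum>k\<in>UNIV. (v$j * v$k) * dirderiv (axis k 1) (dirderiv (axis j 1) p) y)" for v y
  proof -
    have e: "dirderiv v p = (\<lambda>y. \<Sum>j\<in>UNIV. v$j * dirderiv (axis j 1) p y)"
      by (rule ext) (rule dirderiv_axis_expand[OF p])
    have r: "real_polynomial_function (\<lambda>y. v$j * dirderiv (axis j 1) p y)" for j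
      using P1 by auto
    have "dirderiv v (dirderiv v p) y = (\<Sum>j\<in>UNIV. v$j * dirderiv v (dirderiv (axis j 1) p) y)"
      by (subst e, subst dirderiv_sum) (simp_all add: r dirderiv_cmult P1)
    also have "\<dots> = (\<Sum>j\<in>UNIV. \<Sum>k\<in>UNIV. (v$j * v$k) * dirderiv (axis k 1) (dirderiv (axis j 1) p) y)"
      by (simp add: dirderiv_axis_expand[OF P1, of v] sum_distrib_left mult.assoc)
    finally show ?thesis .
  qed
  have "laplacian (\<lambda>x. p (T x)) x = (\<Sum>i\<in>UNIV. dirderiv (T (axis i 1)) (dirderiv (T (axis i 1)) p) (T x))"
    by (simp add: laplacian_real_polynomial real_polynomial_compose_linear p lin dirderiv_compose_linear P1)
  also have "\<dots> = (\<Sum>i\<in>UNIV. \<Sum>j\<in>UNIV. \<Sum>k\<in>UNIV. (T (axis i 1) $ j * T (axis i 1) $ k)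
      * dirderiv (axis k 1) (dirderiv (axis j 1) p) (T x))"
    by (intro sum.cong refl exp2)
  also have "\<dots> = (\<Sum>j\<in>UNIV. \<Sum>i\<in>UNIV. \<Sum>k\<in>UNIV. (T (axis i 1) $ j * T (axis i 1) $ k)
      * dirderiv (axis k 1) (dirderiv (axis j 1) p) (T x))"
    by (rule sum.swap)
  also have "\<dots> = (\<Sum>j\<in>UNIV. \<Sum>k\<in>UNIV. \<Sum>i\<in>UNIV. (T (axis i 1) $ j * T (axis i 1) $ k)
      * dirderiv (axis k 1) (dirderiv (axis j 1) p) (T x))"
    by (rule sum.cong[OF refl], rule sum.swap)
  also have "\<dots> = (\<Sum>j\<in>UNIV. \<Sum>k\<in>UNIV. (if j = k then 1 else 0) * dirderiv (axis k 1) (dirderiv (axis j 1) p) (T x))"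
    by (intro sum.cong refl) (simp add: sum_distrib_right[symmetric] delta)
  also have "\<dots> = laplacian p (T x)"
    by (simp add: laplacian_real_polynomial p if_distrib[of "\<lambda>c. c * _"] cong: if_cong)
  finally show ?thesis .
qed

lemma spherical_harmonic_orthogonal:
  fixes T :: "real^'n \<Rightarrow> real^'n"
  assumes "spherical_harmonic l f" and T: "orthogonal_transformation T"
  shows "spherical_harmonic l (\<lambda>x. f (T x))"
proof -
  from assms(1) obtain p where p: "real_polynomial_function p" "\<forall>c x. p (c *\<^sub>R x) = c ^ l * p x"
    "\<forall>x. laplacian p x = 0" "\<forall>x\<in>unit_sphere. f x = p x"
    unfolding spherical_harmonic_def by blast
  have lin: "linear T" using T by (rule orthogonal_transformation_linear)
  show ?thesis unfolding spherical_harmonic_def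
    using p lin
    by (intro exI[of _ "\<lambda>x. p (T x)"])
       (auto simp: real_polynomial_compose_linear laplacian_orthogonal T linear_cmul orthogonal_transformation_norm[OF T])
qed

lemma continuous_on_spherical_harmonic:
  assumes "spherical_harmonic l f"
  shows "continuous_on unit_sphere f"
proof -
  obtain p where "harmonic_form l p" "\<And>x. norm x = 1 \<Longrightarrow> f x = p x"
    using spherical_harmonic_form[OF assms] by blast
  then show ?thesis
    by (subst continuous_on_cong[OF refl, of _ _ p]) (auto intro: continuous_on_real_polynomial harmonic_form_polynomial)
qed

lemma integral_cong_sphere:
  "(\<And>x. norm x = 1 \<Longrightarrow> f x = g x) \<Longrightarrow> (LINT x|sphere_measure. f x) = (LINT x|sphere_measure. g x)"
  by (rule Bochner_Integration.integral_cong) auto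

lemma harmonic_onb_coefficient:
  fixes B :: "(real^'n \<Rightarrow> real) set"
  assumes B: "harmonic_onb l B" and f: "\<And>x. norm x = 1 \<Longrightarrow> f x = (\<Sum>g\<in>B. c g * g x)" and g: "g \<in> B"
  shows "(LINT x|sphere_measure. f x * g x) = c g"
proof -
  have i: "integrable sphere_measure (\<lambda>x. h x * g x)" if "h \<in> B" for h
    using B that g by (intro integrable_sphere_measure continuous_intros continuous_on_spherical_harmonic[of l])
      (auto simp: harmonic_onb_def)
  have "(LINT x|sphere_measure. f x * g x) = (LINT x|sphere_measure. (\<Sum>h\<in>B. c h * (h x * g x)))"
    by (rule integral_cong_sphere) (simp add: f sum_distrib_right mult.assoc)
  also have "\<dots> = (\<Sum>h\<in>B. c h * (LINT x|sphere_measure. h x * g x))"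
    using i by simp
  also have "\<dots> = (\<Sum>h\<in>B. if h = g then c h else 0)"
    using B g by (intro sum.cong) (auto simp: harmonic_onb_def)
  also have "\<dots> = c g" using g B by (simp add: harmonic_onb_def)
  finally show ?thesis .
qed

text \<open>The sum of the products \<open>f x * f y\<close> over the basis is a reproducing kernel
  and therefore invariant under rotations; a rotation taking \<open>x\<close> to \<open>z\<close>
  relates the two diagonal values.\<close>

lemma harmonic_onb_diagonal_const:
  fixes B :: "(real^'n \<Rightarrow> real) set"
  assumes B: "harmonic_onb l B" and x: "norm x = 1" and z: "norm z = 1"
  shows "(\<Sum>f\<in>B. (f z)\<^sup>2) = (\<Sum>f\<in>B. (f x)\<^sup>2)"
proof -
  obtain T where T: "orthogonal_transformation T" and Tx: "T x = z"
    using orthogonal_transformation_exists[of x z] x z by metis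
  note T' = orthogonal_transformation_inv[OF T]
  note nT = orthogonal_transformation_norm[OF T]
  have inv: "inv T (T y) = y" for y
    using orthogonal_transformation_inj[OF T] by simp
  have fin: "finite B" and sh: "\<And>f. f \<in> B \<Longrightarrow> spherical_harmonic l f"
    and ex: "\<And>f. spherical_harmonic l f \<Longrightarrow> \<exists>c. \<forall>x. norm x = 1 \<longrightarrow> f x = (\<Sum>g\<in>B. c g * g x)"
    using B by (auto simp: harmonic_onb_def Ball_def)
  have "\<forall>f\<in>B. \<exists>c. \<forall>y. norm y = 1 \<longrightarrow> f (T y) = (\<Sum>g\<in>B. c g * g y)"
    using ex[OF spherical_harmonic_orthogonal[OF sh T]] by simp
  from bchoice[OF this] obtain c
    where c: "\<And>f y. f \<in> B \<Longrightarrow> norm y = 1 \<Longrightarrow> f (T y) = (\<Sum>g\<in>B. c f g * g y)" by auto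
  have "\<forall>g\<in>B. \<exists>d. \<forall>y. norm y = 1 \<longrightarrow> g (inv T y) = (\<Sum>f\<in>B. d f * f y)"
    using ex[OF spherical_harmonic_orthogonal[OF sh T']] by simp
  from bchoice[OF this] obtain d
    where d: "\<And>g y. g \<in> B \<Longrightarrow> norm y = 1 \<Longrightarrow> g (inv T y) = (\<Sum>f\<in>B. d g f * f y)" by auto
  \<comment> \<open>By invariance of the measure, composition with \<open>T\<close> and composition
    with \<open>inv T\<close> have transposed matrices in the orthonormal basis.\<close>
  have cd: "c f g = d g f" if f: "f \<in> B" and g: "g \<in> B" for f g
  proof -
    have cont: "continuous_on unit_sphere (\<lambda>y. f y * g (inv T y))"
      by (intro continuous_intros continuous_on_spherical_harmonic[of l] sh f g spherical_harmonic_orthogonal[OF _ T'])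
    have "c f g = (LINT y|sphere_measure. f (T y) * g y)"
      using harmonic_onb_coefficient[OF B, of "\<lambda>y. f (T y)" "c f" g] c f g by simp
    also have "\<dots> = (LINT y|sphere_measure. f y * g (inv T y))"
      using integral_sphere_orthogonal[OF T cont] by (simp add: inv)
    also have "\<dots> = d g f"
      using harmonic_onb_coefficient[OF B, of "\<lambda>y. g (inv T y)" "d g" f] d f g by (simp add: mult.commute)
    finally show ?thesis .
  qed
  have "(\<Sum>f\<in>B. (f z)\<^sup>2) = (\<Sum>f\<in>B. f z * f (T x))" by (simp add: Tx power2_eq_square)
  also have "\<dots> = (\<Sum>f\<in>B. \<Sum>g\<in>B. f z * (d g f * g x))"
    using x by (intro sum.cong refl) (simp add: c cd sum_distrib_left)
  also have "\<dots> = (\<Sum>g\<in>B. (\<Sum>f\<in>B. d g f * f z) * g x)"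
    by (subst sum.swap) (simp add: sum_distrib_left sum_distrib_right mult_ac)
  also have "\<dots> = (\<Sum>g\<in>B. g (inv T z) * g x)"
    using z by (intro sum.cong refl) (simp add: d)
  also have "\<dots> = (\<Sum>f\<in>B. (f x)\<^sup>2)" by (simp add: inv Tx[symmetric] power2_eq_square)
  finally show ?thesis .
qed

text \<open>A constant equals its mean over a probability measure, and every basis element
  contributes 1 to the mean.\<close>

lemma harmonic_onb_diagonal:
  fixes B :: "(real^'n \<Rightarrow> real) set"
  assumes B: "harmonic_onb l B" and x: "norm x = 1"
  shows "(\<Sum>f\<in>B. (f x)\<^sup>2) = card B"
proof -
  have i: "integrable sphere_measure (\<lambda>x. (f x)\<^sup>2)" if "f \<in> B" for f
    using B that by (intro integrable_sphere_measure continuous_intros continuous_on_spherical_harmonic[of l])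
      (auto simp: harmonic_onb_def)
  have "(\<Sum>f\<in>B. (f x)\<^sup>2) = (LINT z|(sphere_measure :: (real^'n) measure). (\<Sum>f\<in>B. (f x)\<^sup>2))"
    by (simp add: sphere_measure.prob_space[simplified])
  also have "\<dots> = (LINT z|sphere_measure. (\<Sum>f\<in>B. (f z)\<^sup>2))"
    by (rule integral_cong_sphere) (rule harmonic_onb_diagonal_const[OF B, symmetric, OF x])
  also have "\<dots> = (\<Sum>f\<in>B. LINT z|sphere_measure. (f z)\<^sup>2)" using i by simp
  also have "\<dots> = (\<Sum>f\<in>B. 1)"
    using B by (intro sum.cong) (auto simp: harmonic_onb_def power2_eq_square)
  finally show ?thesis by simp
qed

section \<open>The gradient on the product of spheres\<close>

text \<open>The great circle through \<open>x\<close> with initial velocity \<open>u\<close>. As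
  \<open>sgn 0 = 0\<close>, the formula covers \<open>u = 0\<close> too, with a constant
  curve.\<close>

lemma sphere_curve:
  fixes x u :: "real^'n"
  assumes x: "norm x = 1" and u: "u \<bullet> x = 0"
  defines "\<gamma> \<equiv> \<lambda>t::real. cos (norm u * t) *\<^sub>R x + sin (norm u * t) *\<^sub>R sgn u"
  shows "\<gamma> 0 = x" and "norm (\<gamma> t) = 1" and "(\<gamma> has_derivative (\<lambda>t. t *\<^sub>R u)) (at 0)"
proof -
  show "\<gamma> 0 = x" by (simp add: \<gamma>_def)
  have xs: "x \<bullet> sgn u = 0" "x \<bullet> x = 1" using u x by (auto simp: sgn_div_norm inner_commute dot_square_norm)
  have "(norm (\<gamma> t))\<^sup>2 = 1"
  proof (cases "u = 0")
    case False
    then have ss: "sgn u \<bullet> sgn u = 1" by (simp add: dot_square_norm norm_sgn)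
    have "(norm (\<gamma> t))\<^sup>2 = (cos (norm u * t))^2 + (sin (norm u * t))^2"
      unfolding power2_norm_eq_inner \<gamma>_def
      by (simp add: inner_add_left inner_add_right inner_commute[of "sgn u" x] xs ss power2_eq_square del: sin_cos_squared_add2)
    then show ?thesis by simp
  qed (simp add: \<gamma>_def x)
  then show "norm (\<gamma> t) = 1" using norm_ge_zero[of "\<gamma> t"] by (auto simp: power2_eq_1_iff)
  have "(\<gamma> has_vector_derivative norm u *\<^sub>R sgn u) (at 0)"
    unfolding \<gamma>_def by (auto intro!: derivative_eq_intros)
  moreover have "norm u *\<^sub>R sgn u = u" by (cases "u = 0") (simp_all add: sgn_div_norm)
  ultimately show "(\<gamma> has_derivative (\<lambda>t. t *\<^sub>R u)) (at 0)" by (simp add: has_vector_derivative_def)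
qed

text \<open>Along a curve in \<open>sphere2\<close> with initial velocity \<open>w\<close> the
  derivative is both \<open>w \<bullet> w\<close> and zero. Applied to the difference of two
  candidates, this makes the description in \<open>sphere2_gradient\<close> definite.\<close>

lemma sphere2_tangent_derivative_unique:
  fixes p w :: "(real^'n) \<times> (real^'n)"
  assumes p: "p \<in> sphere2" and w: "fst w \<bullet> fst p = 0" "snd w \<bullet> snd p = 0"
    and d: "((\<lambda>_. c) has_derivative (\<lambda>v. w \<bullet> v)) (at p within sphere2)"
  shows "w = 0"
proof -
  have n: "norm (fst p) = 1" "norm (snd p) = 1" using p by auto
  define \<gamma> where "\<gamma> t = (cos (norm (fst w) * t) *\<^sub>R fst p + sin (norm (fst w) * t) *\<^sub>R sgn (fst w),
    cos (norm (snd w) * t) *\<^sub>R snd p + sin (norm (snd w) * t) *\<^sub>R sgn (snd w))" for t :: real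
  note c1 = sphere_curve[OF n(1) w(1)] and c2 = sphere_curve[OF n(2) w(2)]
  have g: "(\<gamma> has_derivative (\<lambda>t. (t *\<^sub>R fst w, t *\<^sub>R snd w))) (at 0)"
    unfolding \<gamma>_def by (intro has_derivative_Pair c1(3) c2(3))
  have g0: "\<gamma> 0 = p" by (simp add: \<gamma>_def)
  have "range \<gamma> \<subseteq> sphere2" using c1(2) c2(2) by (auto simp: \<gamma>_def)
  with d have "((\<lambda>_. c) has_derivative (\<lambda>v. w \<bullet> v)) (at (\<gamma> 0) within range \<gamma>)"
    unfolding g0 by (rule has_derivative_subset)
  from has_derivative_in_compose[OF g this]
  have "((\<lambda>t::real. c) has_derivative (\<lambda>t. w \<bullet> (t *\<^sub>R fst w, t *\<^sub>R snd w))) (at 0)" .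
  moreover have "((\<lambda>t::real. c) has_derivative (\<lambda>t. 0)) (at 0)" by simp
  ultimately have "(\<lambda>t. w \<bullet> (t *\<^sub>R fst w, t *\<^sub>R snd w)) = (\<lambda>t. 0)" by (rule has_derivative_unique)
  then have "w \<bullet> (1 *\<^sub>R fst w, 1 *\<^sub>R snd w) = 0" by metis
  then have "w \<bullet> w = 0" by simp
  then show ?thesis by simp
qed

text \<open>On the unit sphere, \<open>q \<bullet> x = 1 - (norm (q - x))\<^sup>2 / 2\<close>, so that \<open>q \<mapsto> q \<bullet> x\<close> is critical at \<open>x\<close>.\<close>

lemma sphere2_normal_derivative:
  fixes p :: "(real^'n) \<times> (real^'n)"
  assumes p: "p \<in> sphere2"
  shows "((\<lambda>q. fst q \<bullet> fst p) has_derivative (\<lambda>v. 0)) (at p within sphere2)"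
    and "((\<lambda>q. snd q \<bullet> snd p) has_derivative (\<lambda>v. 0)) (at p within sphere2)"
proof -
  have *: "a \<bullet> b = 1 - ((a - b) \<bullet> (a - b)) / 2" if "norm a = 1" "norm b = 1" for a b :: "real^'n"
  proof -
    have "a \<bullet> a = 1" "b \<bullet> b = 1" using that by (simp_all add: dot_square_norm)
    then show ?thesis by (simp add: inner_diff_left inner_diff_right inner_commute[of b a] field_simps)
  qed
  have "((\<lambda>q. 1 - ((fst q - fst p) \<bullet> (fst q - fst p)) / 2) has_derivative (\<lambda>v. 0)) (at p within sphere2)"
    by (auto intro!: derivative_eq_intros)
  then show "((\<lambda>q. fst q \<bullet> fst p) has_derivative (\<lambda>v. 0)) (at p within sphere2)"
    by (rule has_derivative_transform[OF p, rotated]) (use p * in auto)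
  have "((\<lambda>q. 1 - ((snd q - snd p) \<bullet> (snd q - snd p)) / 2) has_derivative (\<lambda>v. 0)) (at p within sphere2)"
    by (auto intro!: derivative_eq_intros)
  then show "((\<lambda>q. snd q \<bullet> snd p) has_derivative (\<lambda>v. 0)) (at p within sphere2)"
    by (rule has_derivative_transform[OF p, rotated]) (use p * in auto)
qed

lemma sphere2_gradient_eqI:
  fixes p G :: "(real^'n) \<times> (real^'n)"
  assumes p: "p \<in> sphere2" and F: "(F has_derivative (\<lambda>v. G \<bullet> v)) (at p)"
    and eq: "\<And>q. q \<in> sphere2 \<Longrightarrow> f q = F q"
  shows "sphere2_gradient f p
    = (fst G - (fst p \<bullet> fst G) *\<^sub>R fst p, snd G - (snd p \<bullet> snd G) *\<^sub>R snd p)" (is "_ = ?g")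
proof -
  define a where "a = fst p \<bullet> fst G"
  define b where "b = snd p \<bullet> snd G"
  have pp: "fst p \<bullet> fst p = 1" "snd p \<bullet> snd p = 1" using p by (auto simp: dot_square_norm)
  \<comment> \<open>The same normal terms are subtracted and added. The subtracted ones,
    differentiated as linear functions, remove the normal part of \<open>G\<close>; the added ones
    are critical at \<open>p\<close> within \<open>sphere2\<close> and contribute zero.\<close>
  have "((\<lambda>q. (F q - a * (fst q \<bullet> fst p) - b * (snd q \<bullet> snd p)) + (a * (fst q \<bullet> fst p) + b * (snd q \<bullet> snd p)))
     has_derivative (\<lambda>v. (G \<bullet> v - a * (fst v \<bullet> fst p) - b * (snd v \<bullet> snd p)) + (a * 0 + b * 0))) (at p within sphere2)"
    by (intro has_derivative_add[of "\<lambda>q. F q - a * (fst q \<bullet> fst p) - b * (snd q \<bullet> snd p)"]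
         has_derivative_diff has_derivative_at_withinI[OF F] has_derivative_mult_right
         has_derivative_add sphere2_normal_derivative[OF p] bounded_linear_imp_has_derivative
         bounded_linear_inner_left_comp bounded_linear_fst bounded_linear_snd)
  moreover have "(\<lambda>v. (G \<bullet> v - a * (fst v \<bullet> fst p) - b * (snd v \<bullet> snd p)) + (a * 0 + b * 0)) = (\<lambda>v. ?g \<bullet> v)"
    by (simp add: fun_eq_iff inner_prod_def inner_diff_left a_def b_def inner_commute[of "fst p" "fst _"] inner_commute[of "snd p" "snd _"])
  ultimately have "(F has_derivative (\<lambda>v. ?g \<bullet> v)) (at p within sphere2)" by simp
  then have fg: "(f has_derivative (\<lambda>v. ?g \<bullet> v)) (at p within sphere2)"
    by (rule has_derivative_transform[OF p, rotated]) (rule eq)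
  have tan: "fst ?g \<bullet> fst p = 0" "snd ?g \<bullet> snd p = 0"
    by (simp_all add: inner_diff_left pp) (simp_all add: inner_commute)
  show ?thesis unfolding sphere2_gradient_def
  proof (rule the_equality)
    show "fst ?g \<bullet> fst p = 0 \<and> snd ?g \<bullet> snd p = 0 \<and> (f has_derivative (\<lambda>v. ?g \<bullet> v)) (at p within sphere2)"
      using tan fg by blast
    fix h assume h: "fst h \<bullet> fst p = 0 \<and> snd h \<bullet> snd p = 0 \<and> (f has_derivative (\<lambda>v. h \<bullet> v)) (at p within sphere2)"
    have "((\<lambda>q. f q - f q) has_derivative (\<lambda>v. h \<bullet> v - ?g \<bullet> v)) (at p within sphere2)"
      using h fg by (intro has_derivative_diff) auto
    then have "((\<lambda>q. 0::real) has_derivative (\<lambda>v. (h - ?g) \<bullet> v)) (at p within sphere2)"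
      by (simp add: inner_diff_left)
    from sphere2_tangent_derivative_unique[OF p _ _ this] h tan
    show "h = ?g" by (simp add: inner_diff_left)
  qed
qed

lemma dirderiv_gradient:
  "real_polynomial_function p \<Longrightarrow> dirderiv v p x = gradient p x \<bullet> v"
  using dirderiv_axis_expand[of p v x] by (simp add: gradient_def inner_vec_def mult.commute)

lemma sphere2_gradient_bilinear:
  fixes \<phi> \<psi> :: "'i \<Rightarrow> real^'n \<Rightarrow> real"
  assumes fin: "finite I"
    and \<phi>: "\<And>i. i \<in> I \<Longrightarrow> real_polynomial_function (\<phi> i)"
    and \<psi>: "\<And>i. i \<in> I \<Longrightarrow> real_polynomial_function (\<psi> i)"
    and eq: "\<And>x y. norm x = 1 \<Longrightarrow> norm y = 1 \<Longrightarrow> f (x, y) = (\<Sum>i\<in>I. \<phi> i x * \<psi> i y)"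
    and x: "norm x = 1" and y: "norm y = 1"
  shows "sphere2_gradient f (x, y)
    = ((\<Sum>i\<in>I. \<psi> i y *\<^sub>R sphere_gradient (\<phi> i) x), (\<Sum>i\<in>I. \<phi> i x *\<^sub>R sphere_gradient (\<psi> i) y))"
proof -
  define F where "F q = (\<Sum>i\<in>I. \<phi> i (fst q) * \<psi> i (snd q))" for q
  define G where "G = ((\<Sum>i\<in>I. \<psi> i y *\<^sub>R gradient (\<phi> i) x), (\<Sum>i\<in>I. \<phi> i x *\<^sub>R gradient (\<psi> i) y))"
  have "(F has_derivative (\<lambda>v. \<Sum>i\<in>I. \<phi> i x * dirderiv (snd v) (\<psi> i) y + dirderiv (fst v) (\<phi> i) x * \<psi> i y)) (at (x, y))"
    unfolding F_def
  proof (rule has_derivative_sum)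
    fix i assume i: "i \<in> I"
    have 1: "((\<lambda>q. \<phi> i (fst q)) has_derivative (\<lambda>v. dirderiv (fst v) (\<phi> i) (fst (x, y)))) (at (x, y))"
      by (rule has_derivative_compose[OF has_derivative_fst[OF has_derivative_ident]]) (rule real_polynomial_has_derivative[OF \<phi>[OF i]])
    have 2: "((\<lambda>q. \<psi> i (snd q)) has_derivative (\<lambda>v. dirderiv (snd v) (\<psi> i) (snd (x, y)))) (at (x, y))"
      by (rule has_derivative_compose[OF has_derivative_snd[OF has_derivative_ident]]) (rule real_polynomial_has_derivative[OF \<psi>[OF i]])
    show "((\<lambda>q. \<phi> i (fst q) * \<psi> i (snd q)) has_derivative
        (\<lambda>v. \<phi> i x * dirderiv (snd v) (\<psi> i) y + dirderiv (fst v) (\<phi> i) x * \<psi> i y)) (at (x, y))"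
      using has_derivative_mult[OF 1 2] by simp
  qed
  moreover have "(\<lambda>v. \<Sum>i\<in>I. \<phi> i x * dirderiv (snd v) (\<psi> i) y + dirderiv (fst v) (\<phi> i) x * \<psi> i y) = (\<lambda>v. G \<bullet> v)"
    using \<phi> \<psi> by (simp add: fun_eq_iff G_def inner_prod_def inner_sum_left dirderiv_gradient sum.distrib mult.commute add.commute)
  ultimately have F: "(F has_derivative (\<lambda>v. G \<bullet> v)) (at (x, y))" by simp
  have "sphere2_gradient f (x, y) = (fst G - (x \<bullet> fst G) *\<^sub>R x, snd G - (y \<bullet> snd G) *\<^sub>R y)"
    using sphere2_gradient_eqI[OF _ F, of f] eq x y by (auto simp: F_def)
  also have "\<dots> = ((\<Sum>i\<in>I. \<psi> i y *\<^sub>R sphere_gradient (\<phi> i) x), (\<Sum>i\<in>I. \<phi> i x *\<^sub>R sphere_gradient (\<psi> i) y))"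
    by (simp add: G_def sphere_gradient_def inner_sum_right scaleR_diff_right sum_subtractf scaleR_sum_left)
  finally show ?thesis .
qed

section \<open>Square integrals on the product of spheres\<close>

interpretation sphere2_measure: pair_prob_space "sphere_measure :: (real^'n) measure" "sphere_measure :: (real^'n) measure"
  by standard

lemma space_sphere2_measure [simp]: "space sphere2_measure = sphere2"
  by (simp add: sphere2_measure_def space_pair_measure)

lemma sphere2_product:
  fixes f g :: "real^'n \<Rightarrow> real"
  assumes f: "continuous_on unit_sphere f" and g: "continuous_on unit_sphere g"
  shows "integrable sphere2_measure (\<lambda>p. f (fst p) * g (snd p))"
    and "(LINT p|sphere2_measure. f (fst p) * g (snd p)) = (LINT x|sphere_measure. f x) * (LINT x|sphere_measure. g x)"
proof -
  note m [measurable] = borel_measurable_sphere_measure[OF f] borel_measurable_sphere_measure[OF g]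
  obtain Bf where Bf: "\<And>x. norm x = 1 \<Longrightarrow> \<bar>f x\<bar> \<le> Bf"
  proof -
    have "compact (f ` unit_sphere)" using f compact_continuous_image compact_sphere by blast
    then obtain B where "\<forall>y\<in>f ` unit_sphere. norm y \<le> B" using compact_imp_bounded bounded_iff by blast
    then show ?thesis using that[of B] by simp
  qed
  obtain Bg where Bg: "\<And>x. norm x = 1 \<Longrightarrow> \<bar>g x\<bar> \<le> Bg"
  proof -
    have "compact (g ` unit_sphere)" using g compact_continuous_image compact_sphere by blast
    then obtain B where "\<forall>y\<in>g ` unit_sphere. norm y \<le> B" using compact_imp_bounded bounded_iff by blast
    then show ?thesis using that[of B] by simp
  qed
  have i: "integrable (sphere_measure \<Otimes>\<^sub>M sphere_measure) (\<lambda>p. f (fst p) * g (snd p))"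
  proof (rule sphere2_measure.P.integrable_const_bound[where B="Bf * Bg"])
    show "AE p in sphere_measure \<Otimes>\<^sub>M sphere_measure. norm (f (fst p) * g (snd p)) \<le> Bf * Bg"
    proof (rule AE_I2)
      fix p :: "(real^'n) \<times> (real^'n)" assume "p \<in> space (sphere_measure \<Otimes>\<^sub>M sphere_measure)"
      then have "norm (fst p) = 1" "norm (snd p) = 1" by (auto simp: space_pair_measure)
      then show "norm (f (fst p) * g (snd p)) \<le> Bf * Bg"
        using Bf[of "fst p"] Bg[of "snd p"] by (simp add: abs_mult mult_mono)
    qed
  qed measurable
  then show "integrable sphere2_measure (\<lambda>p. f (fst p) * g (snd p))" by (simp add: sphere2_measure_def)
  have "(LINT p|sphere2_measure. f (fst p) * g (snd p)) = (LINT x|sphere_measure. LINT y|sphere_measure. f (fst (x, y)) * g (snd (x, y)))"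
    unfolding sphere2_measure_def by (rule sphere2_measure.integral_fst'[OF i, symmetric])
  then show "(LINT p|sphere2_measure. f (fst p) * g (snd p)) = (LINT x|sphere_measure. f x) * (LINT x|sphere_measure. g x)"
    by simp
qed

lemma norm_sum_scaleR_square:
  fixes u :: "'i \<Rightarrow> 'b::real_inner"
  shows "(norm (\<Sum>i\<in>I. c i *\<^sub>R u i))\<^sup>2 = (\<Sum>i\<in>I. \<Sum>j\<in>I. (c i * c j) * (u i \<bullet> u j))"
  unfolding power2_norm_eq_inner by (simp add: inner_sum_left inner_sum_right sum_distrib_left mult_ac inner_commute)

text \<open>Expanding the square and factoring by Fubini, orthonormality in one variable removes the
  cross terms whatever the inner products of the \<open>u i\<close> are. Vector values allow the
  \<open>u i\<close> to be gradients; the two versions serve the two components of the product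
  gradient.\<close>

lemma sphere2_orthonormal_sum:
  fixes u :: "'i \<Rightarrow> real^'n \<Rightarrow> 'b::real_inner" and e :: "'i \<Rightarrow> real^'n \<Rightarrow> real"
  assumes fin: "finite I"
    and u: "\<And>i. i \<in> I \<Longrightarrow> continuous_on unit_sphere (u i)"
    and e: "\<And>i. i \<in> I \<Longrightarrow> continuous_on unit_sphere (e i)"
    and on: "\<And>i j. i \<in> I \<Longrightarrow> j \<in> I \<Longrightarrow> (LINT x|sphere_measure. e i x * e j x) = (if i = j then 1 else 0)"
  shows "integrable sphere2_measure (\<lambda>p. (norm (\<Sum>i\<in>I. e i (snd p) *\<^sub>R u i (fst p)))\<^sup>2)"
    and "integrable sphere2_measure (\<lambda>p. (norm (\<Sum>i\<in>I. e i (fst p) *\<^sub>R u i (snd p)))\<^sup>2)"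
    and "(LINT p|sphere2_measure. (norm (\<Sum>i\<in>I. e i (snd p) *\<^sub>R u i (fst p)))\<^sup>2)
      = (\<Sum>i\<in>I. LINT x|sphere_measure. (norm (u i x))\<^sup>2)"
    and "(LINT p|sphere2_measure. (norm (\<Sum>i\<in>I. e i (fst p) *\<^sub>R u i (snd p)))\<^sup>2)
      = (\<Sum>i\<in>I. LINT x|sphere_measure. (norm (u i x))\<^sup>2)"
proof -
  have ce: "continuous_on unit_sphere (\<lambda>y. e i y * e j y)" if "i \<in> I" "j \<in> I" for i j
    using that e by (intro continuous_intros) auto
  have cu: "continuous_on unit_sphere (\<lambda>y. u i y \<bullet> u j y)" if "i \<in> I" "j \<in> I" for i j
    using that u by (intro continuous_intros) auto
  have s: "(\<Sum>j\<in>I. (LINT y|sphere_measure. e i y * e j y) * (LINT x|sphere_measure. u i x \<bullet> u j x))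
      = (LINT x|sphere_measure. (norm (u i x))\<^sup>2)" if "i \<in> I" for i
  proof -
    have "(\<Sum>j\<in>I. (LINT y|sphere_measure. e i y * e j y) * (LINT x|sphere_measure. u i x \<bullet> u j x))
       = (\<Sum>j\<in>I. if i = j then (LINT x|sphere_measure. u i x \<bullet> u j x) else 0)"
      using that by (intro sum.cong) (auto simp: on)
    also have "\<dots> = (LINT x|sphere_measure. (norm (u i x))\<^sup>2)"
      using that fin by (simp add: power2_norm_eq_inner)
    finally show ?thesis .
  qed
  have P1: "integrable sphere2_measure (\<lambda>p. (e i (snd p) * e j (snd p)) * (u i (fst p) \<bullet> u j (fst p)))"
    "(LINT p|sphere2_measure. (e i (snd p) * e j (snd p)) * (u i (fst p) \<bullet> u j (fst p)))
      = (LINT y|sphere_measure. e i y * e j y) * (LINT x|sphere_measure. u i x \<bullet> u j x)"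
    if "i \<in> I" "j \<in> I" for i j
    using sphere2_product[OF cu[OF that] ce[OF that]] by (simp_all add: mult_ac)
  note P2 = sphere2_product[OF ce cu]
  show "integrable sphere2_measure (\<lambda>p. (norm (\<Sum>i\<in>I. e i (snd p) *\<^sub>R u i (fst p)))\<^sup>2)"
    unfolding norm_sum_scaleR_square by (intro Bochner_Integration.integrable_sum P1(1))
  show "integrable sphere2_measure (\<lambda>p. (norm (\<Sum>i\<in>I. e i (fst p) *\<^sub>R u i (snd p)))\<^sup>2)"
    unfolding norm_sum_scaleR_square by (intro Bochner_Integration.integrable_sum P2(1))
  have "(LINT p|sphere2_measure. (norm (\<Sum>i\<in>I. e i (snd p) *\<^sub>R u i (fst p)))\<^sup>2)
     = (\<Sum>i\<in>I. \<Sum>j\<in>I. (LINT p|sphere2_measure. (e i (snd p) * e j (snd p)) * (u i (fst p) \<bullet> u j (fst p))))"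
    unfolding norm_sum_scaleR_square using P1(1) by simp
  also have "\<dots> = (\<Sum>i\<in>I. LINT x|sphere_measure. (norm (u i x))\<^sup>2)"
    by (intro sum.cong refl, subst s[symmetric]) (auto intro!: sum.cong simp: P1(2))
  finally show "(LINT p|sphere2_measure. (norm (\<Sum>i\<in>I. e i (snd p) *\<^sub>R u i (fst p)))\<^sup>2)
      = (\<Sum>i\<in>I. LINT x|sphere_measure. (norm (u i x))\<^sup>2)" .
  have "(LINT p|sphere2_measure. (norm (\<Sum>i\<in>I. e i (fst p) *\<^sub>R u i (snd p)))\<^sup>2)
     = (\<Sum>i\<in>I. \<Sum>j\<in>I. (LINT p|sphere2_measure. (e i (fst p) * e j (fst p)) * (u i (snd p) \<bullet> u j (snd p))))"
    unfolding norm_sum_scaleR_square using P2(1) by simp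
  also have "\<dots> = (\<Sum>i\<in>I. LINT x|sphere_measure. (norm (u i x))\<^sup>2)"
    by (intro sum.cong refl, subst s[symmetric]) (auto intro!: sum.cong simp: P2(2))
  finally show "(LINT p|sphere2_measure. (norm (\<Sum>i\<in>I. e i (fst p) *\<^sub>R u i (snd p)))\<^sup>2)
      = (\<Sum>i\<in>I. LINT x|sphere_measure. (norm (u i x))\<^sup>2)" .
qed

lemma orthonormal_sum_square:
  fixes e :: "'i \<Rightarrow> real^'n \<Rightarrow> real"
  assumes fin: "finite I"
    and e: "\<And>i. i \<in> I \<Longrightarrow> continuous_on unit_sphere (e i)"
    and on: "\<And>i j. i \<in> I \<Longrightarrow> j \<in> I \<Longrightarrow> (LINT x|sphere_measure. e i x * e j x) = (if i = j then 1 else 0)"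
  shows "(LINT x|sphere_measure. (\<Sum>i\<in>I. c i * e i x)\<^sup>2) = (\<Sum>i\<in>I. (c i)\<^sup>2)"
proof -
  have i: "integrable sphere_measure (\<lambda>x. e i x * e j x)" if "i \<in> I" "j \<in> I" for i j
    using that e by (intro integrable_sphere_measure continuous_intros) auto
  have "(LINT x|sphere_measure. (\<Sum>i\<in>I. c i * e i x)\<^sup>2)
      = (LINT x|sphere_measure. (\<Sum>i\<in>I. \<Sum>j\<in>I. (c i * c j) * (e i x * e j x)))"
    by (simp add: power2_eq_square sum_product mult_ac)
  also have "\<dots> = (\<Sum>i\<in>I. \<Sum>j\<in>I. (c i * c j) * (LINT x|sphere_measure. e i x * e j x))"
    using i by simp
  also have "\<dots> = (\<Sum>i\<in>I. \<Sum>j\<in>I. if i = j then c i * c j else 0)"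
    by (intro sum.cong refl) (simp add: on)
  also have "\<dots> = (\<Sum>i\<in>I. (c i)\<^sup>2)" using fin by (simp add: power2_eq_square)
  finally show ?thesis .
qed

section \<open>Limits in \<open>L\<^sup>2\<close> of the fibres\<close>

text \<open>The Bochner integral of a non-integrable function is 0 by convention, so a bound on it
  proves nothing. A bound on the nonnegative integral gives integrability together with the
  estimate.\<close>

lemma integral_le_of_nn_integral_le:
  fixes g :: "'a \<Rightarrow> real"
  assumes m: "g \<in> borel_measurable M" and g: "\<And>x. 0 \<le> g x" and t: "0 \<le> t"
    and le: "(\<integral>\<^sup>+x. ennreal (g x) \<partial>M) \<le> ennreal t"
  shows "integrable M g" and "(LINT x|M. g x) \<le> t"
proof -
  show i: "integrable M g"
    using m g le by (intro integrableI_nonneg) (auto intro: le_less_trans)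
  have "ennreal (LINT x|M. g x) \<le> ennreal t"
    using nn_integral_eq_integral[OF i] g le by simp
  then show "(LINT x|M. g x) \<le> t" using t by simp
qed

lemma square_integrable_diff:
  assumes "square_integrable M f" "square_integrable M g"
  shows "square_integrable M (\<lambda>x. f x - g x)"
proof -
  have m [measurable]: "f \<in> borel_measurable M" "g \<in> borel_measurable M"
    and i: "integrable M (\<lambda>x. 2 * (f x)\<^sup>2 + 2 * (g x)\<^sup>2)"
    using assms by (auto simp: square_integrable_def)
  have "integrable M (\<lambda>x. (f x - g x)\<^sup>2)"
  proof (rule Bochner_Integration.integrable_bound[OF i])
    show "AE x in M. norm ((f x - g x)\<^sup>2) \<le> norm (2 * (f x)\<^sup>2 + 2 * (g x)\<^sup>2)"
    proof (rule AE_I2)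
      fix x
      have "(f x - g x)\<^sup>2 + (f x + g x)\<^sup>2 = 2 * (f x)\<^sup>2 + 2 * (g x)\<^sup>2"
        by (simp add: power2_eq_square algebra_simps)
      moreover have "0 \<le> (f x + g x)\<^sup>2" by simp
      ultimately have "(f x - g x)\<^sup>2 \<le> 2 * (f x)\<^sup>2 + 2 * (g x)\<^sup>2" by linarith
      then show "norm ((f x - g x)\<^sup>2) \<le> norm (2 * (f x)\<^sup>2 + 2 * (g x)\<^sup>2)" by simp
    qed
  qed simp
  then show ?thesis by (simp add: square_integrable_def)
qed

text \<open>The parallelogram identity for \<open>f - g\<close> and \<open>g - h\<close>, as a
  triangle inequality for squares; the constant 2 is harmless for bounds that tend to 0.\<close>

lemma integral_square_diff_le:
  assumes "square_integrable M f" "square_integrable M g" "square_integrable M h"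
  shows "(LINT x|M. (f x - h x)\<^sup>2) \<le> 2 * (LINT x|M. (f x - g x)\<^sup>2) + 2 * (LINT x|M. (g x - h x)\<^sup>2)"
proof -
  have i: "integrable M (\<lambda>x. (f x - g x)\<^sup>2)" "integrable M (\<lambda>x. (g x - h x)\<^sup>2)" "integrable M (\<lambda>x. (f x - h x)\<^sup>2)"
    using square_integrable_diff assms by (auto simp: square_integrable_def)
  have "(LINT x|M. (f x - h x)\<^sup>2) \<le> (LINT x|M. 2 * (f x - g x)\<^sup>2 + 2 * (g x - h x)\<^sup>2)"
  proof (rule integral_mono[OF i(3)])
    show "integrable M (\<lambda>x. 2 * (f x - g x)\<^sup>2 + 2 * (g x - h x)\<^sup>2)" using i by simp
    fix x
    have "(f x - h x)\<^sup>2 + (f x - 2 * g x + h x)\<^sup>2 = 2 * (f x - g x)\<^sup>2 + 2 * (g x - h x)\<^sup>2"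
      by (simp add: power2_eq_square algebra_simps)
    moreover have "0 \<le> (f x - 2 * g x + h x)\<^sup>2" by simp
    ultimately show "(f x - h x)\<^sup>2 \<le> 2 * (f x - g x)\<^sup>2 + 2 * (g x - h x)\<^sup>2" by linarith
  qed
  also have "\<dots> = 2 * (LINT x|M. (f x - g x)\<^sup>2) + 2 * (LINT x|M. (g x - h x)\<^sup>2)" using i by simp
  finally show ?thesis .
qed

text \<open>The argument of Riesz and Fischer: increments with summable integrals are absolutely
  summable at almost every point, and the series telescopes.\<close>

lemma AE_convergent_of_L2_increments:
  fixes s :: "nat \<Rightarrow> 'b \<Rightarrow> real"
  assumes "finite_measure N" and s: "\<And>k. square_integrable N (s k)"
    and le: "\<And>k. (LINT y|N. (s (Suc k) y - s k y)\<^sup>2) \<le> (1/4) ^ k"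
  shows "AE y in N. convergent (\<lambda>k. s k y)"
proof -
  interpret finite_measure N by fact
  define D where "D k y = \<bar>s (Suc k) y - s k y\<bar>" for k y
  have sq: "integrable N (\<lambda>y. (D k y)\<^sup>2)" for k
    using square_integrable_diff[OF s s] by (simp add: square_integrable_def D_def)
  have m [measurable]: "s k \<in> borel_measurable N" for k using s by (simp add: square_integrable_def)
  have mD [measurable]: "D k \<in> borel_measurable N" for k unfolding D_def by measurable
  define c where "c = (1 + measure N (space N)) / 2"
  \<comment> \<open>The weight \<open>2 ^ k\<close> balances the two terms: it turns the assumed
    \<open>(1/4) ^ k\<close> into \<open>(1/2) ^ k\<close>, and the finite mass takes care of the
    additive constant.\<close>
  have amgm: "D k y \<le> (2 ^ k * (D k y)\<^sup>2 + (1/2) ^ k) / 2" for k y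
  proof -
    have "0 \<le> 2 ^ k * (D k y - (1/2) ^ k)\<^sup>2" by simp
    also have "\<dots> = 2 ^ k * (D k y)\<^sup>2 + (2 ^ k * (1/2) ^ k) * (1/2) ^ k - 2 * (2 ^ k * (1/2) ^ k) * D k y"
      by (simp add: power2_eq_square algebra_simps)
    also have "2 ^ k * (1/2) ^ k = (1::real)" by (simp add: power_mult_distrib[symmetric])
    finally show ?thesis by simp
  qed
  have iR: "integrable N (\<lambda>y. (2 ^ k * (D k y)\<^sup>2 + (1/2) ^ k) / 2)" for k using sq by simp
  have iD: "integrable N (D k)" for k
    by (rule Bochner_Integration.integrable_bound[OF iR[of k]])
      (use amgm[of k] in \<open>auto simp: D_def intro!: AE_I2 order_trans[OF _ abs_ge_self]\<close>)
  have D_le: "(LINT y|N. D k y) \<le> c * (1/2) ^ k" for k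
  proof -
    have "(LINT y|N. D k y) \<le> (LINT y|N. (2 ^ k * (D k y)\<^sup>2 + (1/2) ^ k) / 2)"
      by (rule integral_mono[OF iD iR]) (rule amgm)
    also have "\<dots> = (2 ^ k * (LINT y|N. (D k y)\<^sup>2) + (1/2) ^ k * measure N (space N)) / 2"
      using sq by (simp add: mult.commute)
    also have "\<dots> \<le> (2 ^ k * (1/4) ^ k + (1/2) ^ k * measure N (space N)) / 2"
      using le[of k] by (simp add: D_def)
    also have "2 ^ k * (1/4) ^ k = (1/2 :: real) ^ k" by (simp add: power_mult_distrib[symmetric])
    finally show ?thesis by (simp add: c_def algebra_simps)
  qed
  have c0: "0 \<le> c" by (simp add: c_def)
  have "(\<integral>\<^sup>+y. (\<Sum>k. ennreal (D k y)) \<partial>N) = (\<Sum>k. \<integral>\<^sup>+y. ennreal (D k y) \<partial>N)"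
    by (rule nn_integral_suminf) simp
  also have "\<dots> \<le> (\<Sum>k. ennreal (c * (1/2) ^ k))"
  proof (rule suminf_le[OF _ summableI summableI])
    fix k
    have "(\<integral>\<^sup>+y. ennreal (D k y) \<partial>N) = ennreal (LINT y|N. D k y)"
      by (rule nn_integral_eq_integral[OF iD]) (simp add: D_def)
    also have "\<dots> \<le> ennreal (c * (1/2) ^ k)" by (rule ennreal_leI[OF D_le])
    finally show "(\<integral>\<^sup>+y. ennreal (D k y) \<partial>N) \<le> ennreal (c * (1/2) ^ k)" .
  qed
  also have "\<dots> < \<infinity>"
  proof -
    have "summable (\<lambda>k. c * (1/2) ^ k)" by (intro summable_mult summable_geometric) simp
    then have "(\<Sum>k. ennreal (c * (1/2) ^ k)) \<noteq> top" using c0 by (intro ennreal_suminf_neq_top) simp_all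
    then show ?thesis by (simp add: less_top)
  qed
  finally have "(\<integral>\<^sup>+y. (\<Sum>k. ennreal (D k y)) \<partial>N) \<noteq> \<infinity>" by simp
  then have "AE y in N. (\<Sum>k. ennreal (D k y)) \<noteq> \<infinity>"
    by (rule nn_integral_PInf_AE[rotated]) simp
  then show ?thesis
  proof eventually_elim
    case (elim y)
    then have "summable (\<lambda>k. D k y)" by (intro summable_suminf_not_top) (auto simp: D_def)
    then have "summable (\<lambda>k. s (Suc k) y - s k y)" unfolding D_def by (rule summable_rabs_cancel)
    then have "convergent (\<lambda>n. \<Sum>k<n. s (Suc k) y - s k y)" by (simp add: summable_iff_convergent)
    also have "(\<lambda>n. \<Sum>k<n. s (Suc k) y - s k y) = (\<lambda>n. s n y - s 0 y)"
      by (rule ext) (rule sum_lessThan_telescope)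
    finally have "convergent (\<lambda>n. s n y - s 0 y)" .
    then have "convergent (\<lambda>n. (s n y - s 0 y) + s 0 y)" by (rule convergent_add[OF _ convergent_const])
    then show ?case by simp
  qed
qed

text \<open>One subsequence works for all fibres, which makes the limit jointly measurable.\<close>

lemma L2_fiber_limit:
  fixes S :: "nat \<Rightarrow> 'a \<Rightarrow> 'b \<Rightarrow> real"
  assumes N: "finite_measure N"
    and Sm: "\<And>k. (\<lambda>(x, y). S k x y) \<in> borel_measurable (M \<Otimes>\<^sub>M N)"
    and Si: "\<And>x k. x \<in> space M \<Longrightarrow> square_integrable N (S k x)"
    and le: "\<And>x k m. x \<in> space M \<Longrightarrow> k \<le> m \<Longrightarrow> (LINT y|N. (S m x y - S k x y)\<^sup>2) \<le> \<tau> k"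
    and \<tau>: "\<tau> \<longlonglongrightarrow> 0" "\<And>k. 0 \<le> \<tau> k"
  shows "\<exists>K. (\<lambda>(x, y). K x y) \<in> borel_measurable (M \<Otimes>\<^sub>M N) \<and>
    (\<forall>x\<in>space M. square_integrable N (K x) \<and> (\<forall>k. (LINT y|N. (S k x y - K x y)\<^sup>2) \<le> \<tau> k))"
proof -
  have small: "\<exists>j>i. \<tau> j \<le> (1/4) ^ k" for i k
  proof -
    have "eventually (\<lambda>j. \<tau> j < (1/4) ^ k) sequentially" by (rule order_tendstoD(2)[OF \<tau>(1)]) simp
    then obtain j0 where "\<And>j. j \<ge> j0 \<Longrightarrow> \<tau> j < (1/4) ^ k" unfolding eventually_sequentially by blast
    then show ?thesis by (intro exI[of _ "max j0 (Suc i)"]) (auto intro: less_imp_le)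
  qed
  \<comment> \<open>The subsequence depends on \<open>\<tau>\<close> alone and so does not involve
    \<open>x\<close>; the rate is the one required by
    \<open>AE_convergent_of_L2_increments\<close>.\<close>
  have "\<exists>r. \<forall>k. \<tau> (r k) \<le> (1/4) ^ k \<and> r k < r (Suc k)"
    by (rule dependent_nat_choice) (use small in blast)+
  then obtain r where r: "\<And>k. \<tau> (r k) \<le> (1/4) ^ k" "\<And>k. r k < r (Suc k)" by blast
  have r_ge: "k \<le> r k" for k
    using r(2) by (intro seq_suble) (simp add: strict_mono_Suc_iff)
  \<comment> \<open>Where the subsequence diverges, \<open>lim\<close> takes an unspecified value,
    but only on a null set of each fibre; as an operation on all sequences it preserves joint
    measurability.\<close>
  define K where "K x y = lim (\<lambda>k. S (r k) x y)" for x y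
  have Km: "(\<lambda>(x, y). K x y) \<in> borel_measurable (M \<Otimes>\<^sub>M N)"
    unfolding K_def split_def using Sm[unfolded split_def] by (rule borel_measurable_lim_metric)
  have "square_integrable N (K x) \<and> (\<forall>k. (LINT y|N. (S k x y - K x y)\<^sup>2) \<le> \<tau> k)" if x: "x \<in> space M" for x
  proof -
    have [measurable]: "S k x \<in> borel_measurable N" for k using Si[OF x] by (simp add: square_integrable_def)
    have [measurable]: "K x \<in> borel_measurable N" using measurable_Pair2[OF Km x] by simp
    have "AE y in N. convergent (\<lambda>k. S (r k) x y)"
      using le[OF x less_imp_le[OF r(2)]] r(1)
      by (intro AE_convergent_of_L2_increments[OF N] Si[OF x]) (meson order_trans)
    then have conv: "AE y in N. (\<lambda>k. S (r k) x y) \<longlonglongrightarrow> K x y"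
      by eventually_elim (simp add: K_def convergent_LIMSEQ_iff)
    have *: "integrable N (\<lambda>y. (S k x y - K x y)\<^sup>2)" "(LINT y|N. (S k x y - K x y)\<^sup>2) \<le> \<tau> k" for k
    proof -
      \<comment> \<open>Fatou's lemma carries the bound between two members of the sequence over to
        the limit. For \<open>j \<ge> k\<close> also \<open>r j \<ge> k\<close>, as
        \<open>le\<close> demands.\<close>
      have "(\<integral>\<^sup>+y. ennreal ((S k x y - K x y)\<^sup>2) \<partial>N) = (\<integral>\<^sup>+y. liminf (\<lambda>j. ennreal ((S (r j) x y - S k x y)\<^sup>2)) \<partial>N)"
      proof (rule nn_integral_cong_AE, use conv in eventually_elim)
        case (elim y)
        have "(\<lambda>j. ennreal ((S (r j) x y - S k x y)\<^sup>2)) \<longlonglongrightarrow> ennreal ((K x y - S k x y)\<^sup>2)"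
          by (intro tendsto_intros elim)
        from lim_imp_Liminf[OF _ this] show ?case by (simp add: power2_commute)
      qed
      also have "\<dots> \<le> liminf (\<lambda>j. \<integral>\<^sup>+y. ennreal ((S (r j) x y - S k x y)\<^sup>2) \<partial>N)"
        by (rule nn_integral_liminf) simp
      also have "\<dots> \<le> limsup (\<lambda>j. \<integral>\<^sup>+y. ennreal ((S (r j) x y - S k x y)\<^sup>2) \<partial>N)"
        by (rule Liminf_le_Limsup) simp
      also have "\<dots> \<le> ennreal (\<tau> k)"
      proof (rule Limsup_bounded, unfold eventually_sequentially, intro exI allI impI)
        fix j assume "k \<le> j"
        then have "k \<le> r j" using r_ge[of j] by simp
        have "integrable N (\<lambda>y. (S (r j) x y - S k x y)\<^sup>2)"
          using square_integrable_diff[OF Si[OF x] Si[OF x]] by (simp add: square_integrable_def)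
        from nn_integral_eq_integral[OF this] le[OF x \<open>k \<le> r j\<close>]
        show "(\<integral>\<^sup>+y. ennreal ((S (r j) x y - S k x y)\<^sup>2) \<partial>N) \<le> ennreal (\<tau> k)"
          by (simp add: ennreal_leI)
      qed
      finally have nn: "(\<integral>\<^sup>+y. ennreal ((S k x y - K x y)\<^sup>2) \<partial>N) \<le> ennreal (\<tau> k)" .
      show "integrable N (\<lambda>y. (S k x y - K x y)\<^sup>2)" "(LINT y|N. (S k x y - K x y)\<^sup>2) \<le> \<tau> k"
        by (rule integral_le_of_nn_integral_le[OF _ _ \<tau>(2) nn]; simp)+
    qed
    have "square_integrable N (\<lambda>y. S 0 x y - (S 0 x y - K x y))"
      by (rule square_integrable_diff[OF Si[OF x]]) (use *(1)[of 0] in \<open>simp add: square_integrable_def\<close>)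
    then show ?thesis using *(2) by simp
  qed
  with Km show ?thesis by blast
qed

text \<open>Tonelli over a base of total mass 1: a bound uniform in the fibres is a bound on the
  product.\<close>

lemma L2_pair_of_fibers:
  fixes S K :: "'a \<Rightarrow> 'b \<Rightarrow> real"
  assumes M: "prob_space M" and N: "sigma_finite_measure N"
    and S: "(\<lambda>(x, y). S x y) \<in> borel_measurable (M \<Otimes>\<^sub>M N)"
    and K: "(\<lambda>(x, y). K x y) \<in> borel_measurable (M \<Otimes>\<^sub>M N)"
    and i: "\<And>x. x \<in> space M \<Longrightarrow> square_integrable N (\<lambda>y. S x y - K x y)"
    and le: "\<And>x. x \<in> space M \<Longrightarrow> (LINT y|N. (S x y - K x y)\<^sup>2) \<le> t" and t: "0 \<le> t"
  shows "square_integrable (M \<Otimes>\<^sub>M N) (\<lambda>(x, y). S x y - K x y)"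
    and "(LINT p|(M \<Otimes>\<^sub>M N). ((\<lambda>(x, y). S x y) p - (\<lambda>(x, y). K x y) p)\<^sup>2) \<le> t"
proof -
  interpret M: prob_space M by fact
  interpret N: sigma_finite_measure N by fact
  let ?g = "\<lambda>p. ((\<lambda>(x, y). S x y) p - (\<lambda>(x, y). K x y) p)\<^sup>2"
  note S [measurable] K [measurable]
  have g [measurable]: "?g \<in> borel_measurable (M \<Otimes>\<^sub>M N)" by measurable
  have "(\<integral>\<^sup>+p. ennreal (?g p) \<partial>(M \<Otimes>\<^sub>M N)) = (\<integral>\<^sup>+x. \<integral>\<^sup>+y. ennreal (?g (x, y)) \<partial>N \<partial>M)"
    by (rule N.nn_integral_fst[symmetric]) measurable
  also have "\<dots> \<le> (\<integral>\<^sup>+x. ennreal t \<partial>M)"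
  proof (rule nn_integral_mono)
    fix x assume x: "x \<in> space M"
    have "integrable N (\<lambda>y. (S x y - K x y)\<^sup>2)" using i[OF x] by (simp add: square_integrable_def)
    from nn_integral_eq_integral[OF this] le[OF x]
    show "(\<integral>\<^sup>+y. ennreal (?g (x, y)) \<partial>N) \<le> ennreal t" by (simp add: ennreal_leI)
  qed
  also have "\<dots> = ennreal t" by (simp add: M.emeasure_space_1)
  finally have nn: "(\<integral>\<^sup>+p. ennreal (?g p) \<partial>(M \<Otimes>\<^sub>M N)) \<le> ennreal t" .
  have *: "integrable (M \<Otimes>\<^sub>M N) ?g" "(LINT p|(M \<Otimes>\<^sub>M N). ?g p) \<le> t"
    by (rule integral_le_of_nn_integral_le[OF g _ t nn]; simp)+
  show "(LINT p|(M \<Otimes>\<^sub>M N). ?g p) \<le> t" by (rule *(2))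
  have "(\<lambda>(x, y). S x y - K x y) \<in> borel_measurable (M \<Otimes>\<^sub>M N)" by measurable
  then show "square_integrable (M \<Otimes>\<^sub>M N) (\<lambda>(x, y). S x y - K x y)"
    using *(1) by (simp add: square_integrable_def split_def)
qed

section \<open>Partial sums of zonal expansions\<close>

lemma sphere_gradient_cmult:
  "real_polynomial_function p \<Longrightarrow> sphere_gradient (\<lambda>x. c * p x) x = c *\<^sub>R sphere_gradient p x"
  by (simp add: sphere_gradient_def gradient_def dirderiv_cmult vec_eq_iff inner_vec_def
      sum_distrib_left algebra_simps)

locale harmonic_bases =
  fixes Y :: "nat \<Rightarrow> (real^'n \<Rightarrow> real) set"
  assumes dim: "CARD('n) \<ge> 2" and onb: "\<And>l. harmonic_onb l (Y l)"
begin

text \<open>The degree is kept next to the basis function, since the coefficient and the eigenvalue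
  depend on it.\<close>

definition indices :: "nat set \<Rightarrow> (nat \<times> (real^'n \<Rightarrow> real)) set" where
  "indices A = (SIGMA l:A. Y l)"

definition kernel :: "(nat \<Rightarrow> real) \<Rightarrow> nat set \<Rightarrow> real^'n \<Rightarrow> real^'n \<Rightarrow> real" where
  "kernel b A x y = (\<Sum>l\<in>A. b l * zonal_harmonic Y l x y)"

text \<open>Elements of \<open>Y l\<close> are arbitrary off the sphere, so derivatives are taken of
  a chosen harmonic polynomial with the same values on the sphere.\<close>

definition extension :: "nat \<times> (real^'n \<Rightarrow> real) \<Rightarrow> real^'n \<Rightarrow> real" where
  "extension i = (SOME p. harmonic_form (fst i) p \<and> (\<forall>x. norm x = 1 \<longrightarrow> snd i x = p x))"

lemma finite_Y: "finite (Y l)"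
  using onb by (simp add: harmonic_onb_def)

lemma finite_indices: "finite A \<Longrightarrow> finite (indices A)"
  by (simp add: indices_def finite_Y)

lemma extension:
  assumes "i \<in> indices A"
  shows "harmonic_form (fst i) (extension i)" and "norm x = 1 \<Longrightarrow> snd i x = extension i x"
proof -
  have "snd i \<in> Y (fst i)" using assms by (auto simp: indices_def)
  with harmonic_onb_forms[OF onb, of "fst i"]
  have "\<exists>p. harmonic_form (fst i) p \<and> (\<forall>x. norm x = 1 \<longrightarrow> snd i x = p x)" by metis
  from someI_ex[OF this]
  show "harmonic_form (fst i) (extension i)" "norm x = 1 \<Longrightarrow> snd i x = extension i x"
    by (auto simp: extension_def)
qed

lemmas extension_polynomial = harmonic_form_polynomial[OF extension(1)]

lemma extension_orthonormal:
  assumes i: "i \<in> indices A" and j: "j \<in> indices A"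
  shows "(LINT x|sphere_measure. extension i x * extension j x) = (if i = j then 1 else 0)"
proof (cases "fst i = fst j")
  case True
  have "(LINT x|sphere_measure. extension i x * extension j x) = (LINT x|sphere_measure. snd i x * snd j x)"
    by (rule integral_cong_sphere) (simp add: extension(2)[OF i] extension(2)[OF j])
  also have "\<dots> = (if snd i = snd j then 1 else 0)"
    using onb[of "fst i"] i j True by (auto simp: harmonic_onb_def indices_def)
  finally show ?thesis using True by (simp add: prod_eq_iff)
next
  case False
  then show ?thesis
    using harmonic_forms_orthogonal[OF dim extension(1)[OF i] extension(1)[OF j]] by auto
qed

lemma kernel_extension:
  assumes "finite A" and x: "norm x = 1" and y: "norm y = 1"
  shows "kernel b A x y = (\<Sum>i\<in>indices A. b (fst i) * (extension i x * extension i y))"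
proof -
  have "kernel b A x y = (\<Sum>l\<in>A. \<Sum>f\<in>Y l. b l * (f x * f y))"
    by (simp add: kernel_def zonal_harmonic_def sum_distrib_left)
  also have "\<dots> = (\<Sum>i\<in>indices A. b (fst i) * (snd i x * snd i y))"
    unfolding indices_def using assms(1) finite_Y by (simp add: sum.Sigma split_def)
  also have "\<dots> = (\<Sum>i\<in>indices A. b (fst i) * (extension i x * extension i y))"
    by (intro sum.cong refl) (simp add: extension(2)[OF _ x] extension(2)[OF _ y])
  finally show ?thesis .
qed

lemma kernel_diff:
  assumes "finite A" "B \<subseteq> A"
  shows "kernel b A x y - kernel b B x y = kernel b (A - B) x y"
  using sum.subset_diff[OF assms(2,1), of "\<lambda>l. b l * zonal_harmonic Y l x y"] by (simp add: kernel_def)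

lemma polynomial_fst: "real_polynomial_function p \<Longrightarrow> real_polynomial_function (\<lambda>q :: (real^'n) \<times> (real^'n). p (fst q))"
  using real_polynomial_function_compose[OF polynomial_function_bounded_linear[OF bounded_linear_fst], of p]
  by (simp add: o_def)

lemma polynomial_snd: "real_polynomial_function p \<Longrightarrow> real_polynomial_function (\<lambda>q :: (real^'n) \<times> (real^'n). p (snd q))"
  using real_polynomial_function_compose[OF polynomial_function_bounded_linear[OF bounded_linear_snd], of p]
  by (simp add: o_def)

lemma Ck_kernel:
  assumes "finite A"
  shows "Ck_submanifold \<infinity> sphere2 (\<lambda>(x, y). kernel b A x y)"
proof -
  define F where "F q = (\<Sum>i\<in>indices A. b (fst i) * (extension i (fst q) * extension i (snd q)))" for q
  have "real_polynomial_function F"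
    unfolding F_def using finite_indices[OF assms]
    by (intro real_polynomial_function_sum real_polynomial_function.intros(2,4) polynomial_fst polynomial_snd
        extension_polynomial)
  moreover have "F q = (\<lambda>(x, y). kernel b A x y) q" if "q \<in> sphere2" for q
    using that kernel_extension[OF assms] by (auto simp: F_def)
  ultimately show ?thesis
    unfolding Ck_submanifold_def by (intro ballI exI[of _ UNIV] exI[of _ F]) (auto intro: Ck_on_real_polynomial)
qed

lemma borel_measurable_extension:
  "i \<in> indices A \<Longrightarrow> extension i \<in> borel_measurable sphere_measure"
  by (intro borel_measurable_sphere_measure continuous_on_real_polynomial extension_polynomial)

lemma borel_measurable_kernel:
  assumes "finite A"
  shows "(\<lambda>(x, y). kernel b A x y) \<in> borel_measurable sphere2_measure"
proof -
  have "(\<lambda>q. \<Sum>i\<in>indices A. b (fst i) * (extension i (fst q) * extension i (snd q))) \<in> borel_measurable sphere2_measure"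
    unfolding sphere2_measure_def
    by (intro borel_measurable_sum borel_measurable_times borel_measurable_const
        measurable_compose[OF measurable_fst borel_measurable_extension]
        measurable_compose[OF measurable_snd borel_measurable_extension])
  moreover have "(\<lambda>(x, y). kernel b A x y) \<in> borel_measurable sphere2_measure \<longleftrightarrow>
     (\<lambda>q. \<Sum>i\<in>indices A. b (fst i) * (extension i (fst q) * extension i (snd q))) \<in> borel_measurable sphere2_measure"
    by (rule measurable_cong) (auto simp: kernel_extension[OF assms])
  ultimately show ?thesis by blast
qed

lemma continuous_on_kernel:
  assumes "finite A" and x: "norm x = 1"
  shows "continuous_on unit_sphere (kernel b A x)"
proof -
  have "continuous_on unit_sphere (\<lambda>y. \<Sum>i\<in>indices A. b (fst i) * (extension i x * extension i y))"
    by (intro continuous_intros continuous_on_real_polynomial extension_polynomial)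
  then show ?thesis
    by (subst continuous_on_cong[OF refl]) (auto simp: kernel_extension[OF assms])
qed

lemma square_integrable_kernel:
  assumes "finite A" and x: "norm x = 1"
  shows "square_integrable sphere_measure (kernel b A x)"
  unfolding square_integrable_def using continuous_on_kernel[OF assms]
  by (intro conjI borel_measurable_sphere_measure integrable_sphere_measure continuous_intros)

text \<open>Parseval in \<open>y\<close> leaves the diagonal of the zonal harmonics at
  \<open>x\<close>, which is constant. The absence of \<open>x\<close> on the right is what makes
  all fibre estimates uniform.\<close>

lemma integral_kernel_square:
  assumes "finite A" and x: "norm x = 1"
  shows "(LINT y|sphere_measure. (kernel b A x y)\<^sup>2) = (\<Sum>l\<in>A. (b l)\<^sup>2 * card (Y l))"
proof -
  have "(LINT y|sphere_measure. (kernel b A x y)\<^sup>2)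
      = (LINT y|sphere_measure. (\<Sum>i\<in>indices A. (b (fst i) * extension i x) * extension i y)\<^sup>2)"
    by (rule integral_cong_sphere) (simp add: kernel_extension[OF assms] mult.assoc)
  also have "\<dots> = (\<Sum>i\<in>indices A. (b (fst i) * extension i x)\<^sup>2)"
    by (rule orthonormal_sum_square[OF finite_indices[OF assms(1)]])
      (auto intro: continuous_on_real_polynomial extension_polynomial simp: extension_orthonormal)
  also have "\<dots> = (\<Sum>i\<in>indices A. (b (fst i))\<^sup>2 * (snd i x)\<^sup>2)"
    by (intro sum.cong refl) (simp add: extension(2)[OF _ x] power_mult_distrib)
  also have "\<dots> = (\<Sum>l\<in>A. \<Sum>f\<in>Y l. (b l)\<^sup>2 * (f x)\<^sup>2)"
    unfolding indices_def using assms(1) finite_Y by (simp add: sum.Sigma split_def)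
  also have "\<dots> = (\<Sum>l\<in>A. (b l)\<^sup>2 * card (Y l))"
    by (simp add: sum_distrib_left[symmetric] harmonic_onb_diagonal[OF onb x])
  finally show ?thesis .
qed

lemma sphere2_gradient_kernel:
  assumes "finite A" and x: "norm x = 1" and y: "norm y = 1"
  shows "sphere2_gradient (\<lambda>(x, y). kernel b A x y) (x, y) =
    ((\<Sum>i\<in>indices A. extension i y *\<^sub>R (b (fst i) *\<^sub>R sphere_gradient (extension i) x)),
     (\<Sum>i\<in>indices A. extension i x *\<^sub>R (b (fst i) *\<^sub>R sphere_gradient (extension i) y)))"
proof -
  have "sphere2_gradient (\<lambda>(x, y). kernel b A x y) (x, y) =
    ((\<Sum>i\<in>indices A. extension i y *\<^sub>R sphere_gradient (\<lambda>x. b (fst i) * extension i x) x),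
     (\<Sum>i\<in>indices A. (b (fst i) * extension i x) *\<^sub>R sphere_gradient (extension i) y))"
    by (rule sphere2_gradient_bilinear[OF finite_indices[OF assms(1)] _ _ _ x y])
      (auto intro: real_polynomial_function.intros(2,4) extension_polynomial
        simp: kernel_extension[OF assms(1)] mult.assoc)
  also have "(\<Sum>i\<in>indices A. extension i y *\<^sub>R sphere_gradient (\<lambda>x. b (fst i) * extension i x) x)
      = (\<Sum>i\<in>indices A. extension i y *\<^sub>R (b (fst i) *\<^sub>R sphere_gradient (extension i) x))"
    by (intro sum.cong refl) (simp only: sphere_gradient_cmult[OF extension_polynomial])
  also have "(\<Sum>i\<in>indices A. (b (fst i) * extension i x) *\<^sub>R sphere_gradient (extension i) y)
      = (\<Sum>i\<in>indices A. extension i x *\<^sub>R (b (fst i) *\<^sub>R sphere_gradient (extension i) y))"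
    by (simp add: mult.commute)
  finally show ?thesis .
qed

text \<open>A definite description is not linear by itself; for kernels, linearity is read off from
  the explicit formula.\<close>

lemma sphere2_gradient_kernel_diff:
  assumes "finite A" "B \<subseteq> A" and p: "p \<in> sphere2"
  shows "sphere2_gradient (\<lambda>(x, y). kernel b A x y) p - sphere2_gradient (\<lambda>(x, y). kernel b B x y) p
    = sphere2_gradient (\<lambda>(x, y). kernel b (A - B) x y) p"
proof -
  obtain x y where xy: "p = (x, y)" "norm x = 1" "norm y = 1" using p by (cases p) auto
  have I: "indices (A - B) = indices A - indices B" "indices B \<subseteq> indices A"
    using assms(2) by (auto simp: indices_def)
  have fin: "finite B" "finite (A - B)" using assms finite_subset by auto
  show ?thesis
    unfolding xy(1) sphere2_gradient_kernel[OF assms(1) xy(2,3)] sphere2_gradient_kernel[OF fin(1) xy(2,3)]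
      sphere2_gradient_kernel[OF fin(2) xy(2,3)] I(1)
    by (simp add: sum_diff[OF finite_indices[OF assms(1)] I(2)])
qed

text \<open>In each component, orthonormality in the other variable reduces the square to the
  energies of single harmonics. The two components contribute equally, whence the factor 2.\<close>

lemma integral_sphere2_gradient_kernel:
  assumes "finite A"
  shows "(LINT p|sphere2_measure. (norm (sphere2_gradient (\<lambda>(x, y). kernel b A x y) p))\<^sup>2)
    = 2 * (\<Sum>l\<in>A. (b l)\<^sup>2 * sphere_eigenvalue TYPE('n) l * card (Y l))"
proof -
  define u where "u i x = b (fst i) *\<^sub>R sphere_gradient (extension i) x" for i x
  have cu: "continuous_on unit_sphere (u i)" if "i \<in> indices A" for i
    unfolding u_def using that by (intro continuous_intros continuous_on_sphere_gradient extension_polynomial)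
  have ce: "continuous_on unit_sphere (extension i)" if "i \<in> indices A" for i
    using that by (intro continuous_on_real_polynomial extension_polynomial)
  note S = sphere2_orthonormal_sum[OF finite_indices[OF assms] cu ce extension_orthonormal]
  have "(LINT p|sphere2_measure. (norm (sphere2_gradient (\<lambda>(x, y). kernel b A x y) p))\<^sup>2)
     = (LINT p|sphere2_measure. (norm (\<Sum>i\<in>indices A. extension i (snd p) *\<^sub>R u i (fst p)))\<^sup>2
         + (norm (\<Sum>i\<in>indices A. extension i (fst p) *\<^sub>R u i (snd p)))\<^sup>2)"
    by (rule Bochner_Integration.integral_cong)
      (auto simp: sphere2_gradient_kernel[OF assms] u_def norm_Pair)
  also have "\<dots> = 2 * (\<Sum>i\<in>indices A. LINT x|sphere_measure. (norm (u i x))\<^sup>2)"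
    by (subst Bochner_Integration.integral_add) (use S in simp_all)
  also have "(\<Sum>i\<in>indices A. LINT x|sphere_measure. (norm (u i x))\<^sup>2)
      = (\<Sum>i\<in>indices A. (b (fst i))\<^sup>2 * sphere_eigenvalue TYPE('n) (fst i))"
  proof (intro sum.cong refl)
    fix i assume i: "i \<in> indices A"
    have "(LINT x|sphere_measure. (norm (u i x))\<^sup>2)
       = (b (fst i))\<^sup>2 * (LINT x|sphere_measure. (norm (sphere_gradient (extension i) x))\<^sup>2)"
      by (simp add: u_def power_mult_distrib)
    also have "\<dots> = (b (fst i))\<^sup>2 * sphere_eigenvalue TYPE('n) (fst i)"
      using extension_orthonormal[OF i i] unfolding integral_norm_sphere_gradient[OF extension(1)[OF i]]
      by (simp add: power2_eq_square)
    finally show "(LINT x|sphere_measure. (norm (u i x))\<^sup>2) = (b (fst i))\<^sup>2 * sphere_eigenvalue TYPE('n) (fst i)" .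
  qed
  also have "\<dots> = (\<Sum>l\<in>A. \<Sum>f\<in>Y l. (b l)\<^sup>2 * sphere_eigenvalue TYPE('n) l)"
    unfolding indices_def using assms finite_Y by (subst sum.Sigma) (simp_all add: split_def)
  also have "\<dots> = (\<Sum>l\<in>A. (b l)\<^sup>2 * sphere_eigenvalue TYPE('n) l * card (Y l))"
    by (simp add: mult_ac)
  finally show ?thesis .
qed

lemma sphere_eigenvalue_nonneg: "0 \<le> sphere_eigenvalue TYPE('n) l"
  using dim by (auto simp: sphere_eigenvalue_def)

lemma summable_energy:
  assumes a: "\<And>l. 0 \<le> a l" and s: "summable (\<lambda>l. real l ^ CARD('n) * a l)"
  shows "summable (\<lambda>l. a l * card (Y l))"
    and "summable (\<lambda>l. a l * sphere_eigenvalue TYPE('n) l * card (Y l))"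
proof -
  let ?N = "CARD('n)"
  \<comment> \<open>The factor \<open>?N\<close> bounds the eigenvalue plus 1 against the square of
    \<open>l\<close>; the rest comes from \<open>card_harmonic_onb_le\<close> and
    \<open>l + 1 \<le> 2 * l\<close>. Both need \<open>l \<ge> 1\<close>, and a single term does not
    affect summability. The added 1 lets one estimate serve both series.\<close>
  define C where "C = real ?N * (2 * 2 ^ (?N - 2))"
  have key: "(sphere_eigenvalue TYPE('n) l + 1) * card (Y l) \<le> C * real l ^ ?N" if l: "l \<ge> 1" for l
  proof -
    have "sphere_eigenvalue TYPE('n) l + 1 \<le> real ?N * (real l)\<^sup>2"
    proof -
      have l1: "1 \<le> real l" using l by simp
      have "real l \<le> (real l)\<^sup>2" "1 \<le> (real l)\<^sup>2" using l1 by (simp_all add: self_le_power one_le_power)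
      moreover have "(real ?N - 2) * real l \<le> (real ?N - 2) * (real l)\<^sup>2"
        using calculation dim by (intro mult_left_mono) auto
      ultimately show ?thesis by (simp add: sphere_eigenvalue_def power2_eq_square algebra_simps)
    qed
    moreover have "real (card (Y l)) \<le> 2 * (2 * real l) ^ (?N - 2)"
    proof -
      have "real (card (Y l)) \<le> real (2 * (l + 1) ^ (?N - 2))"
        using card_harmonic_onb_le[OF dim onb[of l]] by (rule of_nat_mono)
      also have "\<dots> = 2 * (real l + 1) ^ (?N - 2)" by (simp add: add.commute)
      also have "\<dots> \<le> 2 * (2 * real l) ^ (?N - 2)" using l by (intro mult_left_mono power_mono) auto
      finally show ?thesis .
    qed
    ultimately have "(sphere_eigenvalue TYPE('n) l + 1) * card (Y l)
        \<le> (real ?N * (real l)\<^sup>2) * (2 * (2 * real l) ^ (?N - 2))"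
      by (intro mult_mono) auto
    also have "\<dots> = C * ((real l)\<^sup>2 * real l ^ (?N - 2))"
      by (simp add: C_def power_mult_distrib)
    also have "(real l)\<^sup>2 * real l ^ (?N - 2) = real l ^ ?N"
      using dim by (metis le_add_diff_inverse power_add)
    finally show ?thesis .
  qed
  have sC: "summable (\<lambda>l. C * (real l ^ ?N * a l))" using s by (rule summable_mult)
  have bound: "a l * ((sphere_eigenvalue TYPE('n) l + 1) * card (Y l)) \<le> C * (real l ^ ?N * a l)" if "l \<ge> 1" for l
    using mult_left_mono[OF key[OF that] a[of l]] by (simp add: mult_ac)
  have parts: "a l * card (Y l) \<le> a l * ((sphere_eigenvalue TYPE('n) l + 1) * card (Y l))"
    "a l * sphere_eigenvalue TYPE('n) l * card (Y l) \<le> a l * ((sphere_eigenvalue TYPE('n) l + 1) * card (Y l))" for l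
    using a[of l] sphere_eigenvalue_nonneg[of l] by (auto simp: algebra_simps)
  show "summable (\<lambda>l. a l * card (Y l))"
  proof (rule summable_comparison_test'[OF sC])
    fix l :: nat assume "1 \<le> l"
    then show "norm (a l * card (Y l)) \<le> C * (real l ^ ?N * a l)"
      using order_trans[OF parts(1) bound] a[of l] by simp
  qed
  show "summable (\<lambda>l. a l * sphere_eigenvalue TYPE('n) l * card (Y l))"
  proof (rule summable_comparison_test'[OF sC])
    fix l :: nat assume "1 \<le> l"
    then show "norm (a l * sphere_eigenvalue TYPE('n) l * card (Y l)) \<le> C * (real l ^ ?N * a l)"
      using order_trans[OF parts(2) bound] a[of l] sphere_eigenvalue_nonneg[of l] by simp
  qed
qed

end

lemma sum_diff_le_tail:
  fixes t :: "nat \<Rightarrow> real"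
  assumes "summable t" "\<And>l. 0 \<le> t l" "k \<le> m"
  shows "sum t ({..m} - {..k}) \<le> suminf t - sum t {..k}"
proof -
  have "sum t ({..m} - {..k}) = sum t {..m} - sum t {..k}" using assms(3) by (intro sum_diff) auto
  also have "sum t {..m} \<le> suminf t" using assms by (intro sum_le_suminf) auto
  finally show ?thesis by simp
qed

theorem lemma2p18:
  fixes Y :: "nat \<Rightarrow> (real^'n \<Rightarrow> real) set"
    and V :: "real \<Rightarrow> real^'n \<Rightarrow> real^'n \<Rightarrow> real"
  assumes "CARD('n) \<ge> 2"
    and "\<And>l. harmonic_onb l (Y l)"
    and "localization Y V"
  shows "\<forall>\<epsilon>>0. (\<exists>K. is_conv_sqrt Y (V \<epsilon>) K) \<and>
                (\<forall>K. is_conv_sqrt Y (V \<epsilon>) K \<longrightarrow> (\<lambda>(x, y). K x y) \<in> H1_sphere2)"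
proof (intro allI impI)
  fix \<epsilon> :: real assume \<epsilon>: "\<epsilon> > 0"
  interpret harmonic_bases Y using assms(1,2) by unfold_locales
  define a where "a = zonal_coeff Y (V \<epsilon>)"
  define b where "b l = sqrt (a l)" for l
  define S where "S L = kernel b {..L}" for L
  have a0: "0 \<le> a l" for l using assms(3) \<epsilon> by (auto simp: localization_def a_def)
  have b2: "(b l)\<^sup>2 = a l" for l using a0 by (simp add: b_def)
  have sa: "summable (\<lambda>l. real l ^ CARD('n) * a l)"
    using assms(3) \<epsilon> by (auto simp: localization_def a_def)
  define t where "t l = a l * card (Y l)" for l
  define t' where "t' l = a l * sphere_eigenvalue TYPE('n) l * card (Y l)" for l
  have st: "summable t" "summable t'" using summable_energy[OF a0 sa] by (simp_all add: t_def[abs_def] t'_def[abs_def])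
  have t0: "0 \<le> t l" "0 \<le> t' l" for l using a0 sphere_eigenvalue_nonneg by (simp_all add: t_def t'_def)
  \<comment> \<open>\<open>\<tau> k\<close> bounds the squared distance of \<open>S k\<close> from
    all later partial sums in every fibre; twice \<open>\<tau>' k\<close> does the same for the
    gradients on the product.\<close>
  define \<tau> where "\<tau> k = suminf t - sum t {..k}" for k
  define \<tau>' where "\<tau>' k = suminf t' - sum t' {..k}" for k
  have lim: "\<tau> \<longlonglongrightarrow> 0" "\<tau>' \<longlonglongrightarrow> 0"
    using tendsto_diff[OF tendsto_const summable_LIMSEQ'[OF st(1)], of "suminf t"]
      tendsto_diff[OF tendsto_const summable_LIMSEQ'[OF st(2)], of "suminf t'"]
    by (simp_all add: \<tau>_def[abs_def] \<tau>'_def[abs_def])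
  have \<tau>0: "0 \<le> \<tau> k" for k using st t0 by (simp add: \<tau>_def sum_le_suminf)
  have S_eq: "S L x y = (\<Sum>l\<le>L. sqrt (zonal_coeff Y (V \<epsilon>) l) * zonal_harmonic Y l x y)" for L x y
    by (simp add: S_def kernel_def a_def b_def)
  have Sm: "(\<lambda>(x, y). S k x y) \<in> borel_measurable sphere2_measure" for k
    unfolding S_def by (rule borel_measurable_kernel) simp
  have Si: "square_integrable sphere_measure (S k x)" if "norm x = 1" for k x
    unfolding S_def using that by (intro square_integrable_kernel) simp_all
  have Sd: "(LINT y|sphere_measure. (S m x y - S k x y)\<^sup>2) \<le> \<tau> k" if "norm x = 1" "k \<le> m" for x k m
  proof -
    have "(LINT y|sphere_measure. (S m x y - S k x y)\<^sup>2) = sum t ({..m} - {..k})"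
      unfolding S_def using that by (simp add: kernel_diff integral_kernel_square b2 t_def)
    also have "\<dots> \<le> \<tau> k" unfolding \<tau>_def by (rule sum_diff_le_tail[OF st(1) t0(1) that(2)])
    finally show ?thesis .
  qed
  have ex: "\<exists>K. is_conv_sqrt Y (V \<epsilon>) K"
  proof -
    obtain K where K: "(\<lambda>(x, y). K x y) \<in> borel_measurable (sphere_measure \<Otimes>\<^sub>M sphere_measure)"
      "\<And>x. x \<in> unit_sphere \<Longrightarrow> square_integrable sphere_measure (K x)"
      "\<And>x k. x \<in> unit_sphere \<Longrightarrow> (LINT y|sphere_measure. (S k x y - K x y)\<^sup>2) \<le> \<tau> k"
      using L2_fiber_limit[of sphere_measure S sphere_measure \<tau>] Sm Si Sd lim(1) \<tau>0
      by (auto simp: sphere_measure.finite_measure_axioms sphere2_measure_def)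
    have "(\<lambda>L. LINT y|sphere_measure. (S L x y - K x y)\<^sup>2) \<longlonglongrightarrow> 0" if "x \<in> unit_sphere" for x
      by (rule tendsto_sandwich[OF _ _ tendsto_const lim(1)])
        (auto intro!: always_eventually K(3)[OF that])
    with K show ?thesis
      unfolding is_conv_sqrt_def S_eq by (intro exI[of _ K]) (auto simp: sphere2_measure_def)
  qed
  have "(\<lambda>(x, y). K x y) \<in> H1_sphere2" if "is_conv_sqrt Y (V \<epsilon>) K" for K
  proof -
    have Km: "(\<lambda>(x, y). K x y) \<in> borel_measurable (sphere_measure \<Otimes>\<^sub>M sphere_measure)"
      and Ki: "\<And>x. norm x = 1 \<Longrightarrow> square_integrable sphere_measure (K x)"
      and Kl: "\<And>x. norm x = 1 \<Longrightarrow> (\<lambda>L. LINT y|sphere_measure. (S L x y - K x y)\<^sup>2) \<longlonglongrightarrow> 0"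
      using that by (auto simp: is_conv_sqrt_def S_eq sphere2_measure_def)
    \<comment> \<open>Here \<open>K\<close> is an arbitrary convolution square root. Its distance to
      \<open>S k\<close> is estimated through a later \<open>S m\<close>, and \<open>m\<close> tends
      to infinity; the 2 stems from \<open>integral_square_diff_le\<close>.\<close>
    have SK: "(LINT y|sphere_measure. (S k x y - K x y)\<^sup>2) \<le> 2 * \<tau> k" if x: "norm x = 1" for x k
    proof (rule tendsto_lowerbound)
      show "(\<lambda>m. 2 * \<tau> k + 2 * (LINT y|sphere_measure. (S m x y - K x y)\<^sup>2)) \<longlonglongrightarrow> 2 * \<tau> k"
        using tendsto_add[OF tendsto_const tendsto_mult[OF tendsto_const Kl[OF x]], of "2 * \<tau> k" 2] by simp
      show "eventually (\<lambda>m. (LINT y|sphere_measure. (S k x y - K x y)\<^sup>2)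
          \<le> 2 * \<tau> k + 2 * (LINT y|sphere_measure. (S m x y - K x y)\<^sup>2)) sequentially"
        using eventually_ge_at_top[of k]
      proof eventually_elim
        case (elim m)
        show ?case
          using integral_square_diff_le[OF Si[OF x, of k] Si[OF x, of m] Ki[OF x]] Sd[OF x elim]
          by (simp add: power2_commute)
      qed
    qed simp
    have P: "square_integrable sphere2_measure (\<lambda>(x, y). S k x y - K x y)"
      "(LINT p|sphere2_measure. ((\<lambda>(x, y). S k x y) p - (\<lambda>(x, y). K x y) p)\<^sup>2) \<le> 2 * \<tau> k" for k
    proof -
      have d: "square_integrable sphere_measure (\<lambda>y. S k x y - K x y)" if "x \<in> space sphere_measure" for x
        using that by (intro square_integrable_diff[OF Si Ki]) simp_all
      have l: "(LINT y|sphere_measure. (S k x y - K x y)\<^sup>2) \<le> 2 * \<tau> k" if "x \<in> space sphere_measure" for x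
        using that by (intro SK) simp
      have t: "0 \<le> 2 * \<tau> k" using \<tau>0 by simp
      show "square_integrable sphere2_measure (\<lambda>(x, y). S k x y - K x y)"
        "(LINT p|sphere2_measure. ((\<lambda>(x, y). S k x y) p - (\<lambda>(x, y). K x y) p)\<^sup>2) \<le> 2 * \<tau> k"
        unfolding sphere2_measure_def
        by (rule L2_pair_of_fibers[OF prob_space_sphere_measure sphere_measure.sigma_finite_measure_axioms
              Sm[unfolded sphere2_measure_def] Km d l t]; assumption)+
    qed
    show ?thesis unfolding H1_sphere2_def
    proof (intro CollectI conjI exI[of _ "\<lambda>k (x, y). S k x y"] allI impI)
      have "square_integrable sphere2_measure (\<lambda>(x, y). S 0 x y)"
      proof -
        \<comment> \<open>Comparison with the zero kernel: the squared norm of \<open>S 0\<close> is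
          \<open>t 0\<close> in every fibre. Then \<open>K\<close> is square integrable as the
          difference of \<open>S 0\<close> and \<open>S 0 - K\<close>.\<close>
        have "square_integrable (sphere_measure \<Otimes>\<^sub>M sphere_measure) (\<lambda>(x, y). S 0 x y - 0)"
        proof (rule L2_pair_of_fibers(1)[OF prob_space_sphere_measure sphere_measure.sigma_finite_measure_axioms])
          show "(\<lambda>(x, y). S 0 x y) \<in> borel_measurable (sphere_measure \<Otimes>\<^sub>M sphere_measure)"
            using Sm[of 0] by (simp add: sphere2_measure_def)
          show "0 \<le> t 0" by (rule t0)
          fix x :: "real^'n" assume "x \<in> space sphere_measure"
          then have x: "norm x = 1" by simp
          show "square_integrable sphere_measure (\<lambda>y. S 0 x y - 0)" using Si[OF x] by simp
          show "(LINT y|sphere_measure. (S 0 x y - 0)\<^sup>2) \<le> t 0"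
            using x by (simp add: S_def integral_kernel_square b2 t_def)
        qed simp
        then show ?thesis by (simp add: sphere2_measure_def)
      qed
      from square_integrable_diff[OF this P(1)[of 0]]
      show "square_integrable sphere2_measure (\<lambda>(x, y). K x y)" by (simp add: split_def)
      show "Ck_submanifold \<infinity> sphere2 (\<lambda>(x, y). S k x y)" for k
        unfolding S_def by (rule Ck_kernel) simp
      have lim2: "(\<lambda>k. 2 * \<tau> k) \<longlonglongrightarrow> 0" using tendsto_mult[OF tendsto_const lim(1), of 2] by simp
      show "(\<lambda>k. LINT p|sphere2_measure. ((\<lambda>(x, y). S k x y) p - (\<lambda>(x, y). K x y) p)\<^sup>2) \<longlonglongrightarrow> 0"
        by (rule tendsto_sandwich[OF _ _ tendsto_const lim2]) (auto intro!: always_eventually P(2)[simplified])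
      fix e :: real assume "e > 0"
      have G: "(LINT p|sphere2_measure. (norm (sphere2_gradient (\<lambda>(x, y). S m x y) p - sphere2_gradient (\<lambda>(x, y). S k x y) p))\<^sup>2)
          \<le> 2 * \<tau>' k" if "k \<le> m" for k m
      proof -
        have "(LINT p|sphere2_measure. (norm (sphere2_gradient (\<lambda>(x, y). S m x y) p - sphere2_gradient (\<lambda>(x, y). S k x y) p))\<^sup>2)
           = (LINT p|sphere2_measure. (norm (sphere2_gradient (\<lambda>(x, y). kernel b ({..m} - {..k}) x y) p))\<^sup>2)"
          unfolding S_def using that
          by (intro Bochner_Integration.integral_cong refl)
             (subst sphere2_gradient_kernel_diff; simp)
        also have "\<dots> = 2 * sum t' ({..m} - {..k})"
          by (subst integral_sphere2_gradient_kernel) (simp_all add: b2 t'_def)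
        also have "\<dots> \<le> 2 * \<tau>' k" unfolding \<tau>'_def using sum_diff_le_tail[OF st(2) t0(2) that] by simp
        finally show ?thesis .
      qed
      have "eventually (\<lambda>k. \<tau>' k < e / 2) sequentially" by (rule order_tendstoD(2)[OF lim(2)]) (use \<open>e > 0\<close> in simp)
      then obtain N where N: "\<And>k. k \<ge> N \<Longrightarrow> \<tau>' k < e / 2" unfolding eventually_sequentially by blast
      show "\<exists>N. \<forall>j\<ge>N. \<forall>k\<ge>N. (LINT p|sphere2_measure. (norm (sphere2_gradient (\<lambda>(x, y). S j x y) p
          - sphere2_gradient (\<lambda>(x, y). S k x y) p))\<^sup>2) < e"
      proof (intro exI[of _ N] allI impI)
        fix j k assume jk: "N \<le> j" "N \<le> k"
        show "(LINT p|sphere2_measure. (norm (sphere2_gradient (\<lambda>(x, y). S j x y) p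
          - sphere2_gradient (\<lambda>(x, y). S k x y) p))\<^sup>2) < e"
        proof (cases "k \<le> j")
          case True
          then show ?thesis using G[OF True] N[OF jk(2)] by simp
        next
          case False
          then have "j \<le> k" by simp
          from G[OF this] N[OF jk(1)] show ?thesis by (simp add: norm_minus_commute)
        qed
      qed
    qed
  qed
  with ex show "(\<exists>K. is_conv_sqrt Y (V \<epsilon>) K) \<and>
      (\<forall>K. is_conv_sqrt Y (V \<epsilon>) K \<longrightarrow> (\<lambda>(x, y). K x y) \<in> H1_sphere2)" by blast
qed

end
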